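(* For any $u<w$ in $W$ with $u\in c_0$, $w\in c_1$ and $l(w)-l(u)\ge5$, we have $\mu(u,w)=0$.
   Context: $W$ is the affine Weyl group of type $\widetilde A_2$: the Coxeter group on $S=\{r,s,t\}$ with $(rs)^3=(st)^3=(rt)^3=1$, with length $l$ and Bruhat order $\le$. For $u<w$, $\mu(u,w)$ is the coefficient of $q^{(l(w)-l(u)-1)/2}$ in the Kazhdan–Lusztig polynomial $P_{u,w}$. $c_1$ is the set of elements $w\neq e$ having a unique reduced expression (the two-sided cell of $\mathbf a$-value 1), and $c_0=W\setminus(\{e\}\cup c_1)$ (the two-sided cell of $\mathbf a$-value 3). *)

theory Defs
  imports
    "HOL-Library.Poly_Mapping"
    "HOL-Computational_Algebra.Polynomial"
begin

section \<open>The Coxeter group of type affine A2\<close>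

datatype gen = gen_r | gen_s | gen_t

inductive cox_eq :: "gen list \<Rightarrow> gen list \<Rightarrow> bool" where
  cox_refl: "cox_eq xs xs"
| cox_sym: "cox_eq xs ys \<Longrightarrow> cox_eq ys xs"
| cox_trans: "cox_eq xs ys \<Longrightarrow> cox_eq ys zs \<Longrightarrow> cox_eq xs zs"
| cox_append: "cox_eq xs ys \<Longrightarrow> cox_eq xs' ys' \<Longrightarrow> cox_eq (xs @ xs') (ys @ ys')"
| cox_square: "cox_eq [a, a] []"
| cox_cube: "a \<noteq> b \<Longrightarrow> cox_eq [a, b, a, b, a, b] []"

lemma equivp_cox_eq: "equivp cox_eq"
  by (rule equivpI) (auto simp: reflp_def symp_def transp_def intro: cox_eq.intros)

lemma cox_eq_rev: "cox_eq xs ys \<Longrightarrow> cox_eq (rev xs) (rev ys)"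
proof (induction rule: cox_eq.induct)
  case (cox_cube a b)
  then show ?case using cox_eq.cox_cube[of b a] by simp
qed (auto intro: cox_eq.intros)

quotient_type weyl = "gen list" / cox_eq
  by (rule equivp_cox_eq)

instantiation weyl :: monoid_mult
begin

lift_definition one_weyl :: weyl is "[]" .

lift_definition times_weyl :: "weyl \<Rightarrow> weyl \<Rightarrow> weyl" is "(@)"
  by (rule cox_append)

instance
proof
  fix a b c :: weyl
  show "a * b * c = a * (b * c)" by transfer (simp add: cox_refl)
  show "1 * a = a" by transfer (simp add: cox_refl)
  show "a * 1 = a" by transfer (simp add: cox_refl)
qed

end

lift_definition word :: "gen list \<Rightarrow> weyl" is "\<lambda>xs. xs" .

lift_definition winv :: "weyl \<Rightarrow> weyl" is rev
  by (rule cox_eq_rev)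

lemma word_append: "word (xs @ ys) = word xs * word ys"
  by transfer (rule cox_refl)

lemma word_surj: "\<exists>xs. word xs = w"
  by transfer (auto intro: cox_refl)

lemma cox_eq_rev_append: "cox_eq (rev xs @ xs) []"
proof (induction xs)
  case (Cons a xs)
  have "cox_eq (rev xs @ ([a, a] @ xs)) (rev xs @ ([] @ xs))"
    by (intro cox_append cox_refl cox_square)
  with Cons show ?case by (auto intro: cox_trans)
qed (simp add: cox_refl)

lemma winv_left: "winv w * w = 1"
  by transfer (rule cox_eq_rev_append)

lemma winv_right: "w * winv w = 1"
proof (transfer)
  fix xs show "cox_eq (xs @ rev xs) []" using cox_eq_rev_append[of "rev xs"] by simp
qed

definition len :: "weyl \<Rightarrow> nat" where
  "len w = (LEAST n. \<exists>xs. word xs = w \<and> length xs = n)"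

definition reduced_expr :: "gen list \<Rightarrow> weyl \<Rightarrow> bool" where
  "reduced_expr xs w \<longleftrightarrow> word xs = w \<and> length xs = len w"

lemma reduced_expr_exists: "\<exists>xs. reduced_expr xs w"
proof -
  have "\<exists>n xs. word xs = w \<and> length xs = n" using word_surj by blast
  then have "\<exists>xs. word xs = w \<and> length xs = len w"
    unfolding len_def by (rule LeastI_ex)
  then show ?thesis by (simp add: reduced_expr_def)
qed

definition reflections :: "weyl set" where
  "reflections = {x * word [a] * winv x | x a. True}"

definition bruhat_step :: "weyl \<Rightarrow> weyl \<Rightarrow> bool" where
  "bruhat_step u w \<longleftrightarrow> len u < len w \<and> (\<exists>\<tau>\<in>reflections. w = u * \<tau>)"

lemma bruhat_steps_len: "bruhat_step\<^sup>*\<^sup>* u w \<Longrightarrow> u = w \<or> len u < len w"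
  by (induction rule: rtranclp_induct) (auto simp: bruhat_step_def)

text \<open>The order on the type is the Bruhat order.\<close>

instantiation weyl :: order
begin

definition less_eq_weyl :: "weyl \<Rightarrow> weyl \<Rightarrow> bool" where
  "u \<le> w \<longleftrightarrow> bruhat_step\<^sup>*\<^sup>* u w"

definition less_weyl :: "weyl \<Rightarrow> weyl \<Rightarrow> bool" where
  "u < w \<longleftrightarrow> u \<le> w \<and> u \<noteq> (w :: weyl)"

instance
proof
  fix u v w :: weyl
  show "u \<le> u" by (simp add: less_eq_weyl_def)
  show "u \<le> v \<Longrightarrow> v \<le> w \<Longrightarrow> u \<le> w" by (simp add: less_eq_weyl_def)
  show antisym: "u \<le> v \<Longrightarrow> v \<le> u \<Longrightarrow> u = v"
    using bruhat_steps_len[of u v] bruhat_steps_len[of v u] by (auto simp: less_eq_weyl_def)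
  show "u < v \<longleftrightarrow> u \<le> v \<and> \<not> v \<le> u"
    using bruhat_steps_len[of u v] bruhat_steps_len[of v u]
    by (auto simp: less_eq_weyl_def less_weyl_def)
qed

end

section \<open>The Hecke algebra\<close>

text \<open>
  Laurent polynomials in \<open>v = q\<^bsup>1/2\<^esup>\<close> over the integers are finitely supported functions
  from exponents to coefficients. The Hecke algebra is the free module over them with
  basis \<open>T\<^sub>w\<close>; its elements are finitely supported functions on the group.
\<close>

type_synonym laurent = "int \<Rightarrow>\<^sub>0 int"

definition vpow :: "int \<Rightarrow> laurent" where
  "vpow k = Poly_Mapping.single k 1"

definition laurent_bar :: "laurent \<Rightarrow> laurent" where
  "laurent_bar = Poly_Mapping.map_key uminus"

type_synonym hecke = "weyl \<Rightarrow>\<^sub>0 laurent"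

definition hscale :: "laurent \<Rightarrow> hecke \<Rightarrow> hecke" where
  "hscale c = Poly_Mapping.map ((*) c)"

definition T :: "weyl \<Rightarrow> hecke" where
  "T w = Poly_Mapping.single w 1"

text \<open>
  Left multiplication by \<open>T\<^sub>a\<close> for a generator \<open>a\<close>. The second case follows from
  \<open>(T\<^sub>a - q) (T\<^sub>a + 1) = 0\<close>, where \<open>q = vpow 2\<close>.
\<close>

definition hecke_gen :: "gen \<Rightarrow> hecke \<Rightarrow> hecke" where
  "hecke_gen a h = (\<Sum>w\<in>Poly_Mapping.keys h. hscale (Poly_Mapping.lookup h w)
     (if len (word [a] * w) > len w then T (word [a] * w)
      else hscale (vpow 2 - 1) (T w) + hscale (vpow 2) (T (word [a] * w))))"

text \<open>
  If \<open>w = a\<^sub>1 \<dots> a\<^sub>k\<close> is reduced then \<open>T\<^sub>w = T\<^sub>a\<^sub>1 \<dots> T\<^sub>a\<^sub>k\<close>; the product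
  does not depend on the reduced expression chosen.
\<close>

definition hecke_mult :: "hecke \<Rightarrow> hecke \<Rightarrow> hecke" where
  "hecke_mult h h' = (\<Sum>w\<in>Poly_Mapping.keys h. hscale (Poly_Mapping.lookup h w)
     (foldr hecke_gen (SOME xs. reduced_expr xs w) h'))"

definition hecke_inv :: "hecke \<Rightarrow> hecke" where
  "hecke_inv h = (THE h'. hecke_mult h h' = T 1 \<and> hecke_mult h' h = T 1)"

definition hecke_bar :: "hecke \<Rightarrow> hecke" where
  "hecke_bar h = (\<Sum>w\<in>Poly_Mapping.keys h.
     hscale (laurent_bar (Poly_Mapping.lookup h w)) (hecke_inv (T (winv w))))"

section \<open>Kazhdan--Lusztig polynomials\<close>

text \<open>A polynomial in \<open>q\<close>, viewed as a Laurent polynomial in \<open>v\<close>.\<close>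

definition laurent_of_qpoly :: "int poly \<Rightarrow> laurent" where
  "laurent_of_qpoly p = (\<Sum>i\<le>degree p. Poly_Mapping.single (2 * int i) (coeff p i))"

definition kl_element :: "weyl \<Rightarrow> (weyl \<Rightarrow> int poly) \<Rightarrow> hecke" where
  "kl_element w p =
     hscale (vpow (- int (len w))) (\<Sum>y\<in>{y. y \<le> w}. hscale (laurent_of_qpoly (p y)) (T y))"

text \<open>
  The degree bound \<open>deg P\<^sub>y\<^sub>,\<^sub>w \<le> (l(w) - l(y) - 1)/2\<close> is doubled to stay in the integers.
\<close>

definition kl_family :: "weyl \<Rightarrow> (weyl \<Rightarrow> int poly) \<Rightarrow> bool" where
  "kl_family w p \<longleftrightarrow>
     p w = 1 \<and>
     (\<forall>y. \<not> y \<le> w \<longrightarrow> p y = 0) \<and>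
     (\<forall>y. y < w \<longrightarrow> 2 * int (degree (p y)) \<le> int (len w) - int (len y) - 1) \<and>
     hecke_bar (kl_element w p) = kl_element w p"

definition KL :: "weyl \<Rightarrow> weyl \<Rightarrow> int poly" where
  "KL y w = (THE p. kl_family w p) y"

text \<open>There is no coefficient of \<open>q\<close> at a half-integral exponent, hence 0 in that case.\<close>

definition mu :: "weyl \<Rightarrow> weyl \<Rightarrow> int" where
  "mu u w = (if odd (len w - len u) then coeff (KL u w) ((len w - len u - 1) div 2) else 0)"

section \<open>The two-sided cells\<close>

definition c1 :: "weyl set" where
  "c1 = {w. w \<noteq> 1 \<and> (\<exists>!xs. reduced_expr xs w)}"

definition c0 :: "weyl set" where
  "c0 = UNIV - ({1} \<union> c1)"

end

theory Submission
  imports Defs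
begin

text \<open>
  An element with a unique reduced expression has a periodic one such as \<open>\<dots>rstrst\<close>. For these
  elements the Kazhdan--Lusztig polynomials are computed explicitly: all of them are 0, 1 or
  \<open>1 + q\<close>. A coefficient \<open>\<mu>(u, w)\<close> with \<open>l(w) - l(u) \<ge> 5\<close> belongs to a power of \<open>q\<close> with exponent
  at least 2, so it vanishes.

  The computation views group elements as affine permutations. Left multiplication by a
  generator then exchanges two values of the inverse permutation and raises the length if and
  only if these values are in increasing order. The supports of the coefficients of 1 and \<open>q\<close>
  are given by linear inequalities between these values, and the recursion
  \<open>C\<^sub>a C\<^sub>w = C\<^sub>a\<^sub>w + \<Sum> \<mu>(z, w) C\<^sub>z\<close> turns into integer arithmetic. It closes up once the
  elements \<open>z\<close> with two left descents that occur in it are included.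
\<close>

section \<open>Lengths and inversions\<close>

text \<open>\<open>hecke_inv\<close> and \<open>KL\<close> are definite descriptions, so the Hecke
  algebra first has to yield genuine inverses and at most one KL family per element. No ring
  structure is set up: left multiplications are linear operators, and those commuting with all right
  multiplications are determined by their value at \<open>T 1\<close>. The recursion carries
  bar-invariance only. Its correction terms are not read off from values of \<open>mu\<close>; they
  come from identities between supports. For a generator \<open>a\<close> and a pair
  \<open>y\<close>, \<open>gn a * y\<close> with the second longer, multiplication by C_a gives both
  members the same coefficient, so each identity concerns a window of three integers with fixed sum.
  Support below \<open>w\<close> and the degree bound are checked at the end, for the periodic words
  alone, and uniqueness identifies the result with \<open>KL\<close>. Even and odd lengths behave
  differently: the step from an even length has two corrections, the step from an odd length a
  single one, which itself involves q.\<close>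

abbreviation gn :: "gen \<Rightarrow> weyl" where "gn a \<equiv> word [a]"

lemma word_eq_iff: "word xs = word ys \<longleftrightarrow> cox_eq xs ys"
  by transfer simp

lemma word_Nil: "word [] = 1"
  by transfer (rule cox_refl)

lemma word_Cons: "word (a # xs) = gn a * word xs"
  using word_append[of "[a]" xs] by simp

lemma winv_word: "winv (word xs) = word (rev xs)"
  by transfer (rule cox_refl)

lemma gn_gn [simp]: "gn a * gn a = 1"
  using cox_square[of a] word_append[of "[a]" "[a]"] by (simp add: word_eq_iff[symmetric] word_Nil)

lemma gn_gn_left [simp]: "gn a * (gn a * w) = w"
  by (simp flip: mult.assoc)

lemma gn_gn_right [simp]: "w * gn a * gn a = w"
  by (simp add: mult.assoc)

lemma winv_left_assoc [simp]: "winv w * (w * x) = x"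
  by (simp add: winv_left flip: mult.assoc)

lemma winv_right_assoc [simp]: "w * (winv w * x) = x"
  by (simp add: winv_right flip: mult.assoc)

lemma winv_gn [simp]: "winv (gn a) = gn a"
  by (simp add: winv_word)

lemma winv_winv [simp]: "winv (winv w) = w"
  by (metis mult.right_neutral winv_right winv_left_assoc)

lemma winv_one [simp]: "winv 1 = 1"
  using winv_left[of 1] by simp

lemma winv_mult: "winv (x * y) = winv y * winv x"
  by (metis mult.assoc mult.right_neutral winv_left_assoc winv_right)

lemma weyl_mult_left_cancel [simp]: "x * y = x * z \<longleftrightarrow> y = (z :: weyl)"
  by (metis winv_left_assoc)

lemma gn_braid: "a \<noteq> b \<Longrightarrow> gn a * (gn b * (gn a * w)) = gn b * (gn a * (gn b * w))"
proof -
  assume "a \<noteq> b"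
  then have "gn a * (gn b * (gn a * (gn b * (gn a * (gn b * x))))) = x" for x
  proof -
    have "word [a, b, a, b, a, b] * x = x"
      using cox_cube[OF \<open>a \<noteq> b\<close>] by (simp flip: word_eq_iff add: word_Nil)
    then show ?thesis by (simp add: word_Cons[of _ "_ # _"] mult.assoc)
  qed
  from this[of "gn b * (gn a * (gn b * w))"] show ?thesis by simp
qed

lemma reduced_expr_obtain: obtains xs where "word xs = w" "length xs = len w"
  using reduced_expr_exists[of w] by (auto simp: reduced_expr_def)

lemma len_word_le: "len (word xs) \<le> length xs"
  unfolding len_def by (rule Least_le) auto

lemma len_one [simp]: "len 1 = 0"
  using len_word_le[of "[]"] by (simp add: word_Nil)

lemma len_gn_mult_le: "len (gn a * w) \<le> Suc (len w)"
proof -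
  obtain xs where "word xs = w" "length xs = len w" by (rule reduced_expr_obtain)
  then show ?thesis using len_word_le[of "a # xs"] by (simp add: word_Cons[of a xs])
qed

lemma len_winv [simp]: "len (winv w) = len w"
proof -
  have "len (winv x) \<le> len x" for x
    by (metis reduced_expr_obtain len_word_le length_rev winv_word)
  from this[of w] this[of "winv w"] show ?thesis by simp
qed

lemma cox_eq_even_length: "cox_eq xs ys \<Longrightarrow> even (length xs) = even (length ys)"
  by (induction rule: cox_eq.induct) auto

lemma even_len_word: "even (len (word xs)) = even (length xs)"
  by (metis cox_eq_even_length reduced_expr_obtain word_eq_iff)

lemma even_len_gn_mult: "even (len (gn a * w)) \<longleftrightarrow> odd (len w)"
  using word_surj[of w] by (metis even_Suc even_len_word length_Cons word_Cons)

lemma len_gn_mult: "len (gn a * w) = Suc (len w) \<or> len w = Suc (len (gn a * w))"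
proof -
  have "len (gn a * w) \<noteq> len w" using even_len_gn_mult[of a w] by auto
  then show ?thesis using len_gn_mult_le[of a w] len_gn_mult_le[of a "gn a * w"] by auto
qed

lemma gn_mult_neq [simp]: "gn a * w \<noteq> w" "w \<noteq> gn a * w"
  using len_gn_mult[of a w] by auto

lemma len_mult_gn: "len (w * gn a) = Suc (len w) \<or> len w = Suc (len (w * gn a))"
  using len_gn_mult[of a "winv w"] len_winv[of "w * gn a"] by (simp add: winv_mult)

lemma obtain_left_descent:
  assumes "w \<noteq> 1"
  obtains a where "len w = Suc (len (gn a * w))"
proof -
  obtain xs where xs: "word xs = w" "length xs = len w" by (rule reduced_expr_obtain)
  with assms obtain a ys where ys: "xs = a # ys" by (cases xs) (auto simp: word_Nil)
  then have "gn a * w = word ys" using xs by (auto simp: word_Cons[of a ys])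
  then show ?thesis
    using that[of a] len_word_le[of ys] len_gn_mult[of a w] xs ys by auto
qed

section \<open>Inversions as a parity cocycle, and the exchange property\<close>

fun invs :: "gen list \<Rightarrow> weyl list" where
  "invs [] = []"
| "invs (a # xs) = (winv (word xs) * gn a * word xs) # invs xs"

lemma invs_append:
  "invs (xs @ ys) = map (\<lambda>\<tau>. winv (word ys) * \<tau> * word ys) (invs xs) @ invs ys"
  by (induction xs) (auto simp: word_append winv_mult mult.assoc)

lemma count_invs_append:
  "count_list (invs (xs @ ys)) \<tau> =
     count_list (invs xs) (word ys * \<tau> * winv (word ys)) + count_list (invs ys) \<tau>"
proof -
  have "count_list (map (\<lambda>\<tau>. winv v * \<tau> * v) zs) \<tau> = count_list zs (v * \<tau> * winv v)" for v zs
    by (induction zs) (auto simp: mult.assoc winv_left winv_right)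
  then show ?thesis by (simp add: invs_append)
qed

text \<open>Each relator lists every reflection an even number of times: \<open>[a, a]\<close> lists
  \<open>gn a\<close> twice, and the braid relator runs twice through the same three reflections.
  The parity of a multiplicity therefore depends on the group element alone.\<close>

lemma cox_eq_odd_count_invs:
  "cox_eq xs ys \<Longrightarrow> odd (count_list (invs xs) \<tau>) = odd (count_list (invs ys) \<tau>)"
proof (induction arbitrary: \<tau> rule: cox_eq.induct)
  case (cox_append xs ys xs' ys')
  moreover have "word xs' = word ys'" using cox_append by (simp add: word_eq_iff)
  ultimately show ?case by (simp add: count_invs_append)
next
  case (cox_square a)
  then show ?case by (simp add: word_Nil)
next
  case (cox_cube a b)
  have *: "gn b * (gn a * (gn b * (gn a * (gn b * (gn a * x))))) = x" for x
    using gn_braid[of b a "gn b * (gn a * x)"] gn_braid[of a b "x"] cox_cube by simp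
  have "invs [a, b, a, b, a, b] =
      (let p = gn b * (gn a * (gn b * (gn a * gn b))); q = gn b * (gn a * gn b)
       in [p, q, gn b, p, q, gn b])"
    unfolding invs.simps winv_word rev.simps append.simps Let_def
    by (simp add: word_Cons[of _ "_ # _"] word_Nil mult.assoc * winv_mult)
  then obtain p q where "invs [a, b, a, b, a, b] = [p, q, gn b, p, q, gn b]" unfolding Let_def by blast
  then show ?case by (simp only: invs.simps(1) count_list.simps) simp
qed blast+

definition ninv :: "weyl \<Rightarrow> weyl \<Rightarrow> bool" where
  "ninv w \<tau> = odd (count_list (invs (SOME xs. word xs = w)) \<tau>)"

lemma ninv_word: "ninv (word xs) \<tau> = odd (count_list (invs xs) \<tau>)"
proof -
  have "word (SOME ys. word ys = word xs) = word xs" by (rule someI) simp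
  then show ?thesis unfolding ninv_def
    by (intro cox_eq_odd_count_invs) (simp add: word_eq_iff)
qed

text \<open>Concatenation conjugates the inversions of the left factor and adds the counts; modulo 2
  this is a symmetric difference.\<close>

lemma ninv_mult: "ninv (x * y) \<tau> \<longleftrightarrow> ninv y \<tau> \<noteq> ninv x (y * \<tau> * winv y)"
proof -
  obtain xs ys where "x = word xs" "y = word ys" using word_surj by metis
  then show ?thesis by (simp add: ninv_word count_invs_append flip: word_append) auto
qed

lemma ninv_one [simp]: "\<not> ninv 1 \<tau>"
  using ninv_word[of "[]" \<tau>] by (simp add: word_Nil)

lemma ninv_gn [simp]: "ninv (gn a) \<tau> \<longleftrightarrow> \<tau> = gn a"
  using ninv_word[of "[a]" \<tau>] by (auto simp: word_Nil)

lemma reflection_square [simp]: "\<tau> \<in> reflections \<Longrightarrow> \<tau> * \<tau> = 1"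
  by (auto simp: reflections_def mult.assoc winv_right)

lemma reflection_conj: "winv y * gn a * y \<in> reflections"
  unfolding reflections_def by clarify (metis winv_winv)

lemma gn_reflection [simp]: "gn a \<in> reflections"
  using reflection_conj[of 1 a] winv_left[of 1] by simp

text \<open>In \<open>x * gn a * winv x\<close> the contributions of the two outer factors agree, by
  the cocycle rule for \<open>x * winv x = 1\<close>, and cancel; the middle letter remains.\<close>

lemma ninv_reflection: assumes "\<tau> \<in> reflections" shows "ninv \<tau> \<tau>"
proof -
  obtain x a where \<tau>: "\<tau> = x * gn a * winv x" using assms by (auto simp: reflections_def)
  have "ninv (x * winv x) \<tau> = False" by (simp add: winv_right)
  then have "ninv (winv x) \<tau> = ninv x (gn a)"
    by (simp add: ninv_mult \<tau> mult.assoc winv_left)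
  moreover have "ninv \<tau> \<tau> \<longleftrightarrow> ninv (winv x) \<tau> \<noteq> ninv (x * gn a) (gn a)"
    by (subst \<tau>, subst ninv_mult) (simp add: \<tau> mult.assoc winv_left)
  ultimately show ?thesis by (simp add: ninv_mult)
qed

text \<open>Right multiplication by the inversion listed at a letter deletes that letter.\<close>

lemma exchange:
  "\<tau> \<in> set (invs xs) \<Longrightarrow> \<exists>ys. length ys < length xs \<and> word ys = word xs * \<tau>"
proof (induction xs)
  case (Cons a xs)
  show ?case
  proof (cases "\<tau> = winv (word xs) * gn a * word xs")
    case True
    then have "word (a # xs) * \<tau> = word xs" by (simp add: word_Cons[of a xs] mult.assoc)
    then show ?thesis by (intro exI[of _ xs]) simp
  next
    case False
    then obtain ys where "length ys < length xs" "word ys = word xs * \<tau>" using Cons by auto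
    then show ?thesis by (intro exI[of _ "a # ys"]) (simp add: word_Cons[of a ys] word_Cons[of a xs] mult.assoc)
  qed
qed simp

lemma len_mult_if_ninv: assumes "ninv w \<tau>" shows "len (w * \<tau>) < len w"
proof -
  obtain xs where xs: "word xs = w" "length xs = len w" by (rule reduced_expr_obtain)
  then have "count_list (invs xs) \<tau> \<noteq> 0" using assms ninv_word[of xs \<tau>] by (metis even_zero)
  then have "\<tau> \<in> set (invs xs)" by (simp add: count_list_0_iff)
  from exchange[OF this] obtain ys where "length ys < len w" "word ys = w * \<tau>" using xs by auto
  then show ?thesis using len_word_le[of ys] by simp
qed

lemma len_mult_if_not_ninv:
  assumes "\<tau> \<in> reflections" "\<not> ninv w \<tau>" shows "len w < len (w * \<tau>)"
proof -
  have "winv \<tau> = \<tau>" using assms(1) by (metis mult.right_neutral reflection_square winv_left_assoc)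
  then have "ninv (w * \<tau>) \<tau>"
    using assms ninv_reflection by (simp add: ninv_mult)
  then show ?thesis using len_mult_if_ninv[of "w * \<tau>" \<tau>] assms(1) by (simp add: mult.assoc)
qed

lemma len_less_mult_iff:
  "\<tau> \<in> reflections \<Longrightarrow> len w < len (w * \<tau>) \<longleftrightarrow> \<not> ninv w \<tau>"
  using len_mult_if_ninv len_mult_if_not_ninv by (meson less_asym)

text \<open>Left multiplication by \<open>gn a\<close> changes the inversion status of just one
  reflection, \<open>winv w * gn a * w\<close>.\<close>

lemma gn_mult_eq_mult_reflection:
  assumes "\<tau> \<in> reflections" "(len w < len (w * \<tau>)) \<noteq> (len (gn a * w) < len (gn a * w * \<tau>))"
  shows "gn a * w = w * \<tau>"
proof -
  have "ninv (gn a) (w * \<tau> * winv w)"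
    using assms by (auto simp: len_less_mult_iff ninv_mult)
  then have "w * \<tau> * winv w = gn a" by simp
  then show ?thesis by (metis mult.assoc mult.right_neutral winv_left)
qed

section \<open>Bruhat order and left multiplication\<close>

lemma le_gn_mult:
  assumes "len w < len (gn a * w)" shows "w \<le> gn a * w"
proof -
  have "gn a * w = w * (winv w * gn a * w)" by (simp add: mult.assoc)
  then have "bruhat_step w (gn a * w)"
    unfolding bruhat_step_def using assms reflection_conj[of w a] by blast
  then show ?thesis by (simp add: less_eq_weyl_def)
qed

text \<open>Left multiplication carries a Bruhat chain from \<open>y\<close> to \<open>w\<close>
  along edge by edge. An edge can fail to rise only if it joins \<open>y\<close> to
  \<open>gn a * y\<close>; then the rest of the chain followed by \<open>w \<le> gn a * w\<close>
  does the job.\<close>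

lemma gn_mult_le_gn_mult:
  assumes "y \<le> w" "len w < len (gn a * w)"
  shows "gn a * y \<le> gn a * w"
  using assms(1)[unfolded less_eq_weyl_def]
proof (induction rule: converse_rtranclp_induct)
  case (step y y')
  then obtain \<tau> where \<tau>: "\<tau> \<in> reflections" "len y < len y'" "y' = y * \<tau>"
    by (auto simp: bruhat_step_def)
  show ?case
  proof (cases "len (gn a * y) < len (gn a * y')")
    case True
    then have "bruhat_step (gn a * y) (gn a * y')"
      using \<tau> by (auto simp: bruhat_step_def mult.assoc)
    then show ?thesis using step.IH by (simp add: less_eq_weyl_def converse_rtranclp_into_rtranclp)
  next
    case False
    then have "gn a * y = y'" using gn_mult_eq_mult_reflection[of \<tau> y a] \<tau> by (simp add: mult.assoc)
    then show ?thesis using step.hyps(2) le_gn_mult[OF assms(2)]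
      by (auto simp: less_eq_weyl_def)
  qed
qed simp

lemma finite_le_weyl: "finite {y :: weyl. y \<le> w}"
proof (rule finite_subset)
  have gen: "finite (UNIV :: gen set)"
  proof (rule finite_subset)
    show "UNIV \<subseteq> {gen_r, gen_s, gen_t}" using gen.exhaust by auto
  qed simp
  show "finite (word ` {xs. set xs \<subseteq> UNIV \<and> length xs \<le> len w})"
    using finite_lists_length_le[OF gen] by (intro finite_imageI) simp
  show "{y. y \<le> w} \<subseteq> word ` {xs. set xs \<subseteq> UNIV \<and> length xs \<le> len w}"
  proof
    fix y assume "y \<in> {y. y \<le> w}"
    then have "len y \<le> len w" using bruhat_steps_len[of y w] by (auto simp: less_eq_weyl_def)
    then show "y \<in> word ` {xs. set xs \<subseteq> UNIV \<and> length xs \<le> len w}"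
      using reduced_expr_obtain[of y] by force
  qed
qed

section \<open>The Hecke algebra and its bar involution\<close>

abbreviation lk :: "hecke \<Rightarrow> weyl \<Rightarrow> laurent" where "lk \<equiv> Poly_Mapping.lookup"

abbreviation qq :: laurent where "qq \<equiv> vpow 2"

abbreviation up :: "gen \<Rightarrow> weyl \<Rightarrow> bool" where "up a w \<equiv> len w < len (gn a * w)"

lemma len_gn_mult_less [simp]: "len (gn a * w) < len w \<longleftrightarrow> \<not> up a w"
  using len_gn_mult[of a w] by auto

lemma len_mult_gn_less [simp]: "len (w * gn a) < len w \<longleftrightarrow> \<not> len w < len (w * gn a)"
  using len_mult_gn[of w a] by auto

lemma vpow_0 [simp]: "vpow 0 = 1"
  by (simp add: vpow_def)

lemma vpow_neq_0 [simp]: "vpow k \<noteq> 0"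
  by (metis lookup_single_eq lookup_zero vpow_def zero_neq_one)

lemma vpow_mult: "vpow k * vpow l = vpow (k + l)"
  by (simp add: vpow_def mult_single)

lemma vpow_mult_assoc: "vpow k * (vpow l * c) = vpow (k + l) * c"
  by (simp add: vpow_mult flip: mult.assoc)

lemma vpow_cancel [simp]: "vpow (- k) * (vpow k * c) = c" "vpow k * (vpow (- k) * c) = c"
  by (simp_all add: vpow_mult_assoc)

lemma lookup_vpow_mult:
  "Poly_Mapping.lookup (vpow k * c) j = Poly_Mapping.lookup c (j - k)"
proof -
  have "j = k + l \<longleftrightarrow> l = j - k" for l by auto
  then have "(c l when j = k + l) = (c l when l = j - k)" for c :: "int \<Rightarrow> int" and l by simp
  then show ?thesis
    unfolding vpow_def by transfer (simp add: prod_fun_def when_mult)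
qed

lemma lookup_laurent_bar: "Poly_Mapping.lookup (laurent_bar c) k = Poly_Mapping.lookup c (- k)"
  by (simp add: laurent_bar_def map_key.rep_eq)

lemma laurent_bar_add: "laurent_bar (c + d) = laurent_bar c + laurent_bar d"
  by (simp add: poly_mapping_eq_iff fun_eq_iff lookup_laurent_bar lookup_add)

lemma laurent_bar_vpow_mult: "laurent_bar (vpow k * c) = vpow (- k) * laurent_bar c"
  by (simp add: poly_mapping_eq_iff fun_eq_iff lookup_laurent_bar lookup_vpow_mult)

lemma laurent_bar_0 [simp]: "laurent_bar 0 = 0"
  by (simp add: laurent_bar_def)

lemma laurent_bar_1 [simp]: "laurent_bar 1 = 1"
  by (simp add: poly_mapping_eq_iff fun_eq_iff lookup_laurent_bar lookup_one)

lemma lookup_hscale [simp]: "lk (hscale c h) w = c * lk h w"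
  by (simp add: hscale_def map.rep_eq when_def)

lemma lookup_T: "lk (T w) y = (if w = y then 1 else 0)"
  by (simp add: T_def lookup_single when_def)

lemma hecke_eqI: "(\<And>y. lk g y = lk h y) \<Longrightarrow> g = h"
  by (rule poly_mapping_eqI)

lemma sum_keys_delta:
  fixes f :: "weyl \<Rightarrow> laurent"
  shows "(\<Sum>w\<in>Poly_Mapping.keys h. lk h w * (if w = z then f w else 0)) = lk h z * f z"
proof -
  have "(\<Sum>w\<in>Poly_Mapping.keys h. lk h w * (if w = z then f w else 0)) =
      (\<Sum>w\<in>Poly_Mapping.keys h. if w = z then lk h w * f w else 0)"
    by (rule sum.cong) auto
  then show ?thesis by (simp add: sum.delta' sum.delta in_keys_iff)
qed

lemma hecke_expand: "h = (\<Sum>w\<in>Poly_Mapping.keys h. hscale (lk h w) (T w))"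
  by (rule hecke_eqI) (simp add: lookup_sum lookup_T sum_keys_delta)

text \<open>Only \<open>T y\<close> and \<open>T (gn a * y)\<close> contribute to the coefficient at
  \<open>y\<close>. Later computations compare coefficients on such pairs.\<close>

lemma lookup_hecke_gen:
  "lk (hecke_gen a h) y =
     (if up a y then qq * lk h (gn a * y) else lk h (gn a * y) + (qq - 1) * lk h y)"
proof -
  have eq: "gn a * w = y \<longleftrightarrow> w = gn a * y" for w by auto
  have "lk (hecke_gen a h) y = (\<Sum>w\<in>Poly_Mapping.keys h.
      lk h w * (if w = gn a * y then if up a w then 1 else qq else 0) +
      lk h w * (if w = y then if up a w then 0 else qq - 1 else 0))"
    unfolding hecke_gen_def lookup_sum
    by (rule sum.cong) (auto simp: lookup_add lookup_T eq algebra_simps)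
  also have "\<dots> = lk h (gn a * y) * (if up a (gn a * y) then 1 else qq) +
      lk h y * (if up a y then 0 else qq - 1)"
    by (simp add: sum.distrib sum_keys_delta)
  finally show ?thesis by (simp add: mult.commute)
qed

definition linear_op :: "(hecke \<Rightarrow> hecke) \<Rightarrow> bool" where
  "linear_op F \<longleftrightarrow> (\<forall>g h. F (g + h) = F g + F h) \<and> (\<forall>c h. F (hscale c h) = hscale c (F h))"

lemma linear_opI:
  assumes "\<And>g h. F (g + h) = F g + F h" "\<And>c h. F (hscale c h) = hscale c (F h)"
  shows "linear_op F"
  using assms by (simp add: linear_op_def)

lemma hscale_0 [simp]: "hscale 0 h = 0" "hscale c 0 = 0"
  by (auto intro: hecke_eqI)

lemma hscale_1 [simp]: "hscale 1 h = h"
  by (auto intro: hecke_eqI)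

lemma linear_op_0: "linear_op F \<Longrightarrow> F 0 = 0"
  by (metis hscale_0(1) linear_op_def)

lemma linear_op_sum: "linear_op F \<Longrightarrow> F (\<Sum>w\<in>S. f w) = (\<Sum>w\<in>S. F (f w))"
  by (induction S rule: infinite_finite_induct) (auto simp: linear_op_0, simp add: linear_op_def)

lemma linear_op_eqI:
  assumes "linear_op F" "linear_op G" "\<And>w. F (T w) = G (T w)"
  shows "F h = G h"
proof -
  have "L h = (\<Sum>w\<in>Poly_Mapping.keys h. hscale (lk h w) (L (T w)))" if "linear_op L" for L
    using that by (subst hecke_expand) (simp add: linear_op_sum, simp add: linear_op_def)
  from this[OF assms(1)] this[OF assms(2)] show ?thesis by (simp add: assms(3))
qed

lemma linear_op_comp: "linear_op F \<Longrightarrow> linear_op G \<Longrightarrow> linear_op (\<lambda>h. F (G h))"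
  by (simp add: linear_op_def)

lemma linear_op_hecke_gen: "linear_op (hecke_gen a)"
  by (intro linear_opI hecke_eqI) (auto simp: lookup_hecke_gen lookup_add algebra_simps)

lemma linear_op_foldr:
  "(\<And>a. linear_op (F a)) \<Longrightarrow> linear_op (foldr F xs)"
proof (induction xs)
  case (Cons a xs)
  then show ?case using linear_op_comp[of "F a" "foldr F xs"] by (simp add: comp_def)
qed (simp add: linear_op_def)

lemma hecke_gen_T_up: "up a w \<Longrightarrow> hecke_gen a (T w) = T (gn a * w)"
  by (rule hecke_eqI) (auto simp: lookup_hecke_gen lookup_T)

definition hecke_gen_inv :: "gen \<Rightarrow> hecke \<Rightarrow> hecke" where
  "hecke_gen_inv a h = hscale (vpow (- 2)) (hecke_gen a h - hscale (qq - 1) h)"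

lemma lookup_hecke_gen_inv:
  "lk (hecke_gen_inv a h) y =
     (if up a y then lk h (gn a * y) - (1 - vpow (- 2)) * lk h y else vpow (- 2) * lk h (gn a * y))"
  using vpow_mult[of "-2" 2]
  by (simp add: hecke_gen_inv_def lookup_minus lookup_hecke_gen algebra_simps)

lemma hecke_gen_inv_left [simp]: "hecke_gen_inv a (hecke_gen a h) = h"
  using vpow_mult[of "-2" 2]
  by (intro hecke_eqI) (auto simp: lookup_hecke_gen_inv lookup_hecke_gen algebra_simps vpow_mult_assoc)

lemma hecke_gen_inv_right [simp]: "hecke_gen a (hecke_gen_inv a h) = h"
  using vpow_mult[of "-2" 2]
  by (intro hecke_eqI) (auto simp: lookup_hecke_gen_inv lookup_hecke_gen algebra_simps vpow_mult_assoc)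

lemma linear_op_hecke_gen_inv: "linear_op (hecke_gen_inv a)"
  by (intro linear_opI hecke_eqI) (auto simp: lookup_hecke_gen_inv lookup_add algebra_simps)

section \<open>Right multiplications and the operators commuting with them\<close>

definition hecke_flip :: "hecke \<Rightarrow> hecke" where
  "hecke_flip = Poly_Mapping.map_key winv"

lemma lookup_hecke_flip [simp]: "lk (hecke_flip h) w = lk h (winv w)"
proof -
  have "inj winv" by (metis injI winv_winv)
  then show ?thesis by (simp add: hecke_flip_def map_key.rep_eq)
qed

definition hecke_gen_right :: "gen \<Rightarrow> hecke \<Rightarrow> hecke" where
  "hecke_gen_right a h = hecke_flip (hecke_gen a (hecke_flip h))"

lemma lookup_hecke_gen_right:
  "lk (hecke_gen_right a h) y =
     (if len y < len (y * gn a) then qq * lk h (y * gn a)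
      else lk h (y * gn a) + (qq - 1) * lk h y)"
proof -
  have "gn a * winv y = winv (y * gn a)" by (simp add: winv_mult)
  then show ?thesis by (simp add: hecke_gen_right_def lookup_hecke_gen)
qed

lemma linear_op_hecke_gen_right: "linear_op (hecke_gen_right a)"
  by (intro linear_opI hecke_eqI) (auto simp: lookup_hecke_gen_right lookup_add algebra_simps)

lemma hecke_gen_right_T_up: "len w < len (w * gn a) \<Longrightarrow> hecke_gen_right a (T w) = T (w * gn a)"
  by (intro hecke_eqI) (auto simp: lookup_hecke_gen_right lookup_T)

text \<open>Left and right ascents at \<open>y\<close> do not influence each other unless
  \<open>gn a * y = y * gn b\<close>; in that case both operators act on the pair \<open>y\<close>,
  \<open>gn a * y\<close> in the same way.\<close>

lemma hecke_gen_commute: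
  "hecke_gen a (hecke_gen_right b h) = hecke_gen_right b (hecke_gen a h)"
proof (rule hecke_eqI)
  fix y
  show "lk (hecke_gen a (hecke_gen_right b h)) y = lk (hecke_gen_right b (hecke_gen a h)) y"
  proof (cases "gn a * y = y * gn b")
    case True
    have "up a y \<longleftrightarrow> len y < len (y * gn b)" using True by simp
    moreover have "gn a * (y * gn b) = y" by (simp flip: True)
    moreover have "up a (y * gn b) \<longleftrightarrow> \<not> up a y" by (simp flip: True)
    moreover have "len (gn a * y) < len (gn a * y * gn b) \<longleftrightarrow> \<not> up a y"
      using calculation by (simp add: mult.assoc)
    ultimately show ?thesis
      using True by (simp add: lookup_hecke_gen lookup_hecke_gen_right mult.assoc)
  next
    case False
    have "len y < len (y * gn b) \<longleftrightarrow> len (gn a * y) < len (gn a * y * gn b)"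
      using False gn_mult_eq_mult_reflection[of "gn b" y a] by auto
    moreover have "up a y \<longleftrightarrow> up a (y * gn b)"
    proof (rule ccontr)
      assume "\<not> ?thesis"
      then have "gn b * winv y = winv y * gn a"
        using gn_mult_eq_mult_reflection[of "gn a" "winv y" b]
          len_winv[of "gn a * y"] len_winv[of "y * gn b"] len_winv[of "gn a * (y * gn b)"]
        by (simp add: winv_mult mult.assoc)
      then have "winv (y * gn b) = winv (gn a * y)" by (simp add: winv_mult)
      then show False using False by (metis winv_winv)
    qed
    ultimately show ?thesis
      by (simp add: lookup_hecke_gen lookup_hecke_gen_right mult.assoc algebra_simps)
  qed
qed

text \<open>\<open>T 1\<close> generates everything under right multiplications, so equality there
  propagates by peeling off right descents. This stands in for associativity of
  \<open>hecke_mult\<close>.\<close>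

lemma right_commuting_ops_eq_on_T:
  assumes "F (T 1) = G (T 1)"
    and "\<And>b h. F (hecke_gen_right b h) = hecke_gen_right b (F h)"
    and "\<And>b h. G (hecke_gen_right b h) = hecke_gen_right b (G h)"
  shows "F (T w) = G (T w)"
proof (induction "len w" arbitrary: w rule: less_induct)
  case less
  show ?case
  proof (cases "w = 1")
    case False
    then have "winv w \<noteq> 1" by (metis winv_winv winv_one)
    then obtain b where "len (winv w) = Suc (len (gn b * winv w))" by (rule obtain_left_descent)
    then have b: "len w = Suc (len (w * gn b))"
      using len_winv[of "w * gn b"] by (simp add: winv_mult)
    then have Tw: "T w = hecke_gen_right b (T (w * gn b))"
      using hecke_gen_right_T_up[of "w * gn b" b] by simp
    have "F (T (w * gn b)) = G (T (w * gn b))" using less[of "w * gn b"] b by simp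
    then show ?thesis unfolding Tw assms(2,3) by simp
  qed (simp add: assms)
qed

lemma right_commuting_op_eqI:
  assumes "linear_op F" "linear_op G" "F (T 1) = G (T 1)"
    and "\<And>b h. F (hecke_gen_right b h) = hecke_gen_right b (F h)"
    and "\<And>b h. G (hecke_gen_right b h) = hecke_gen_right b (G h)"
  shows "F h = G h"
  by (rule linear_op_eqI[OF assms(1,2)], rule right_commuting_ops_eq_on_T[OF assms(3-5)])

lemma foldr_hecke_gen_commute:
  "foldr hecke_gen xs (hecke_gen_right b h) = hecke_gen_right b (foldr hecke_gen xs h)"
  by (induction xs) (simp_all add: hecke_gen_commute)

lemma foldr_hecke_gen_T_1:
  "length xs = len (word xs) \<Longrightarrow> foldr hecke_gen xs (T 1) = T (word xs)"
proof (induction xs)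
  case (Cons a xs)
  have w: "word (a # xs) = gn a * word xs" by (rule word_Cons)
  have len: "length xs = len (word xs)"
    using Cons.prems len_word_le[of xs] len_gn_mult_le[of a "word xs"] unfolding w by simp
  then have "up a (word xs)" using Cons.prems unfolding w by simp
  then have "hecke_gen a (T (word xs)) = T (word (a # xs))" unfolding w by (rule hecke_gen_T_up)
  then show ?case using Cons.IH[OF len] by simp
qed (simp add: word_Nil)

text \<open>Both products send \<open>T 1\<close> to \<open>T w\<close> and commute with right
  multiplications, so no passage between reduced expressions by braid moves is involved.\<close>

lemma foldr_hecke_gen_cong:
  assumes "reduced_expr xs w" "reduced_expr ys w"
  shows "foldr hecke_gen xs h = foldr hecke_gen ys h"
  by (rule right_commuting_op_eqI[of "foldr hecke_gen xs" "foldr hecke_gen ys"])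
     (use assms in \<open>auto simp: foldr_hecke_gen_T_1 reduced_expr_def foldr_hecke_gen_commute
       intro: linear_op_foldr linear_op_hecke_gen\<close>)

lemma foldr_hecke_gen_inv:
  "foldr hecke_gen (rev xs) (foldr hecke_gen_inv xs h) = h"
  "foldr hecke_gen_inv xs (foldr hecke_gen (rev xs) h) = h"
  by (induction xs arbitrary: h) simp_all

lemma reduced_expr_some: "reduced_expr (SOME xs. reduced_expr xs w) w"
  using reduced_expr_exists by (rule someI_ex)

lemma hecke_mult_T:
  assumes "reduced_expr xs w" shows "hecke_mult (T w) h = foldr hecke_gen xs h"
proof -
  have "Poly_Mapping.keys (T w) = {w}" by (simp add: T_def)
  then show ?thesis
    using foldr_hecke_gen_cong[OF reduced_expr_some assms] by (simp add: hecke_mult_def lookup_T)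
qed

lemma linear_op_hecke_mult: "linear_op (hecke_mult h)"
proof -
  have "linear_op (foldr hecke_gen xs)" for xs by (intro linear_op_foldr linear_op_hecke_gen)
  then show ?thesis
    unfolding hecke_mult_def
    by (intro linear_opI hecke_eqI)
       (simp_all add: linear_op_def lookup_sum lookup_add algebra_simps sum.distrib sum_distrib_left)
qed

lemma hecke_mult_right_commute:
  "hecke_mult h (hecke_gen_right b g) = hecke_gen_right b (hecke_mult h g)"
  using linear_op_hecke_gen_right[of b]
  by (simp add: hecke_mult_def foldr_hecke_gen_commute linear_op_sum)
     (simp add: linear_op_def)

lemma hecke_mult_T_1: "hecke_mult h (T 1) = h"
proof -
  have "foldr hecke_gen (SOME xs. reduced_expr xs w) (T 1) = T w" for w
    using foldr_hecke_gen_T_1[of "SOME xs. reduced_expr xs w"] reduced_expr_some[of w]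
    by (simp add: reduced_expr_def)
  then show ?thesis by (simp add: hecke_mult_def flip: hecke_expand)
qed

lemma reduced_expr_rev: "reduced_expr xs w \<Longrightarrow> reduced_expr (rev xs) (winv w)"
  by (auto simp: reduced_expr_def winv_word)

lemma hecke_inv_T_winv:
  assumes xs: "reduced_expr xs w"
  shows "hecke_inv (T (winv w)) = foldr hecke_gen_inv xs (T 1)"
proof -
  define g where "g = foldr hecke_gen_inv xs (T 1)"
  note L = hecke_mult_T[OF reduced_expr_rev[OF xs]]
  \<comment> \<open>Both sides commute with right multiplications, so it suffices to evaluate them at the unit.\<close>
  have "foldr hecke_gen_inv xs h = hecke_mult g h" for h
  proof (rule right_commuting_op_eqI[where F = "foldr hecke_gen_inv xs" and G = "hecke_mult g"])
    show "foldr hecke_gen_inv xs (hecke_gen_right b h) = hecke_gen_right b (foldr hecke_gen_inv xs h)" for b h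
      by (metis foldr_hecke_gen_commute foldr_hecke_gen_inv)
  qed (auto intro: linear_op_foldr linear_op_hecke_gen_inv linear_op_hecke_mult hecke_mult_right_commute
       simp: hecke_mult_T_1 g_def)
  then have "hecke_mult g (T (winv w)) = foldr hecke_gen_inv xs (T (winv w))" by simp
  moreover have "T (winv w) = foldr hecke_gen (rev xs) (T 1)"
    using reduced_expr_rev[OF xs] by (simp add: foldr_hecke_gen_T_1 reduced_expr_def)
  ultimately have "hecke_mult g (T (winv w)) = T 1" by (metis foldr_hecke_gen_inv(2))
  moreover have "hecke_mult (T (winv w)) g = T 1"
    by (simp add: L g_def foldr_hecke_gen_inv)
  moreover have "g' = g" if "hecke_mult (T (winv w)) g' = T 1" for g'
    using that by (metis L foldr_hecke_gen_inv(2) g_def)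
  ultimately show ?thesis unfolding hecke_inv_def g_def[symmetric] by blast
qed

section \<open>The bar involution on the standard basis\<close>

definition bar_T :: "weyl \<Rightarrow> hecke" where
  "bar_T w = hecke_inv (T (winv w))"

lemma bar_T_1: "bar_T 1 = T 1"
  using hecke_inv_T_winv[of "[]" 1] by (simp add: bar_T_def reduced_expr_def word_Nil)

lemma bar_T_up: assumes "up a w" shows "bar_T (gn a * w) = hecke_gen_inv a (bar_T w)"
proof -
  obtain xs where xs: "reduced_expr xs w" using reduced_expr_exists by blast
  have "reduced_expr (a # xs) (gn a * w)"
    using xs assms len_gn_mult[of a w] by (auto simp: reduced_expr_def word_Cons[of a xs])
  then show ?thesis using xs by (simp add: bar_T_def hecke_inv_T_winv)
qed

lemma bar_T_triangular:
  "lk (bar_T w) w = vpow (- 2 * int (len w))"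
  "y \<noteq> w \<Longrightarrow> len w \<le> len y \<Longrightarrow> lk (bar_T w) y = 0"
proof (induction "len w" arbitrary: w y rule: less_induct)
  case less
  show "lk (bar_T w) w = vpow (- 2 * int (len w))"
    and "y \<noteq> w \<Longrightarrow> len w \<le> len y \<Longrightarrow> lk (bar_T w) y = 0" for y
  proof (atomize (full), cases "w = 1")
    case True
    then show "lk (bar_T w) w = vpow (- 2 * int (len w)) \<and>
      (y \<noteq> w \<longrightarrow> len w \<le> len y \<longrightarrow> lk (bar_T w) y = 0)" for y
      by (simp add: bar_T_1 lookup_T)
  next
    case False
    then obtain a where a: "len w = Suc (len (gn a * w))" by (rule obtain_left_descent)
    define x where "x = gn a * w"
    have w: "w = gn a * x" and up: "up a x" and lx: "len w = Suc (len x)"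
      using a by (simp_all add: x_def)
    have IH: "lk (bar_T x) x = vpow (- 2 * int (len x))"
      "\<And>y. y \<noteq> x \<Longrightarrow> len x \<le> len y \<Longrightarrow> lk (bar_T x) y = 0"
      using less[of x] lx by auto
    have bar: "bar_T w = hecke_gen_inv a (bar_T x)" using bar_T_up[OF up] w by simp
    have "lk (bar_T w) w = vpow (- 2 * int (len w))"
    proof -
      have "lk (bar_T w) w = vpow (- 2) * lk (bar_T x) x"
        unfolding bar using up by (simp add: lookup_hecke_gen_inv w)
      then show ?thesis by (simp add: IH(1) lx vpow_mult algebra_simps)
    qed
    moreover have "lk (bar_T w) y = 0" if y: "y \<noteq> w" "len w \<le> len y" for y
    proof -
      have "gn a * y \<noteq> x" using y w by auto
      moreover have "len x \<le> len (gn a * y)" using y lx len_gn_mult[of a y] by auto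
      moreover have "y \<noteq> x" "len x \<le> len y" using y lx by auto
      ultimately show ?thesis by (simp add: bar lookup_hecke_gen_inv IH)
    qed
    ultimately show "lk (bar_T w) w = vpow (- 2 * int (len w)) \<and>
      (y \<noteq> w \<longrightarrow> len w \<le> len y \<longrightarrow> lk (bar_T w) y = 0)" for y by blast
  qed
qed

lemma hecke_bar_superset:
  assumes "finite S" "Poly_Mapping.keys h \<subseteq> S"
  shows "hecke_bar h = (\<Sum>w\<in>S. hscale (laurent_bar (lk h w)) (bar_T w))"
  unfolding hecke_bar_def bar_T_def using assms
  by (intro sum.mono_neutral_left) (auto simp: in_keys_iff)

lemma hecke_bar_add: "hecke_bar (g + h) = hecke_bar g + hecke_bar h"
proof -
  let ?S = "Poly_Mapping.keys g \<union> Poly_Mapping.keys h"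
  have "Poly_Mapping.keys (g + h) \<subseteq> ?S" by (rule keys_add)
  then show ?thesis
    by (intro hecke_eqI)
       (simp add: hecke_bar_superset[of ?S] lookup_sum lookup_add laurent_bar_add algebra_simps sum.distrib)
qed

lemma hecke_bar_diff: "hecke_bar (g - h) = hecke_bar g - hecke_bar h"
  using hecke_bar_add[of "g - h" h] by simp

lemma hecke_bar_hscale_vpow: "hecke_bar (hscale (vpow k) h) = hscale (vpow (- k)) (hecke_bar h)"
proof -
  have "Poly_Mapping.keys (hscale (vpow k) h) \<subseteq> Poly_Mapping.keys h"
    by (auto simp: in_keys_iff)
  then show ?thesis
    by (intro hecke_eqI)
       (simp add: hecke_bar_superset[of "Poly_Mapping.keys h"] lookup_sum laurent_bar_vpow_mult
         sum_distrib_left algebra_simps)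
qed

lemma hecke_bar_hscale_T: "hecke_bar (hscale c (T w)) = hscale (laurent_bar c) (bar_T w)"
proof -
  have "Poly_Mapping.keys (hscale c (T w)) \<subseteq> {w}" by (auto simp: in_keys_iff lookup_T split: if_splits)
  then show ?thesis by (simp add: hecke_bar_superset[of "{w}"] lookup_T)
qed

lemma hecke_bar_sum: "hecke_bar (\<Sum>w\<in>S. f w) = (\<Sum>w\<in>S. hecke_bar (f w))"
proof -
  have "hecke_bar 0 = 0" using hecke_bar_diff[of 0 0] by simp
  then show ?thesis by (induction S rule: infinite_finite_induct) (simp_all add: hecke_bar_add)
qed

text \<open>Left multiplication by the KL element C_a of a generator.\<close>

definition hecke_C :: "gen \<Rightarrow> hecke \<Rightarrow> hecke" where
  "hecke_C a h = hscale (vpow (- 1)) (hecke_gen a h + h)"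

lemma lookup_hecke_C:
  "lk (hecke_C a h) y = vpow (- 1) *
     (if up a y then lk h y + qq * lk h (gn a * y) else lk h (gn a * y) + qq * lk h y)"
  by (simp add: hecke_C_def lookup_add lookup_hecke_gen algebra_simps)

lemma linear_op_hecke_C: "linear_op (hecke_C a)"
  by (intro linear_opI hecke_eqI) (auto simp: lookup_hecke_C lookup_add algebra_simps)

lemma hecke_bar_hecke_gen_T:
  "hecke_bar (hecke_gen a (hscale c (T w))) = hecke_gen_inv a (hscale (laurent_bar c) (bar_T w))"
proof (cases "up a w")
  case True
  then show ?thesis
    using linear_op_hecke_gen[of a] linear_op_hecke_gen_inv[of a]
    by (simp add: linear_op_def hecke_gen_T_up hecke_bar_hscale_T bar_T_up)
next
  case False
  define x where "x = gn a * w"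
  have w: "w = gn a * x" and up: "up a x"
    using False by (simp_all add: x_def)
  have gen: "hecke_gen a (hscale c (T w)) =
      hscale qq (hscale c (T w)) - hscale c (T w) + hscale qq (hscale c (T x))"
    using False by (intro hecke_eqI)
      (auto simp: lookup_hecke_gen lookup_T lookup_add lookup_minus algebra_simps x_def)
  have x: "bar_T x = hecke_gen a (bar_T w)"
    using bar_T_up[OF up] w by simp
  show ?thesis
    unfolding gen hecke_bar_add hecke_bar_diff hecke_bar_hscale_vpow hecke_bar_hscale_T x
    using vpow_mult[of 2 "-2"]
    by (intro hecke_eqI)
       (simp add: lookup_hecke_gen_inv lookup_hecke_gen lookup_add lookup_minus algebra_simps vpow_mult_assoc)
qed

text \<open>The bar involution turns T_a into its inverse, and v (T_a^-1 + 1) = v^-1 (T_a + 1) by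
  the quadratic relation.\<close>

lemma hecke_bar_hecke_C: "hecke_bar (hecke_C a h) = hecke_C a (hecke_bar h)"
proof -
  have inv: "vpow (- 2) * qq = 1" and v: "vpow 1 = vpow (- 1) * qq" by (simp_all add: vpow_mult)
  have up: "vpow 1 * (x - (1 - vpow (- 2)) * y + y) = vpow (- 1) * (y + qq * x)"
    and down: "vpow 1 * (vpow (- 2) * x + y) = vpow (- 1) * (x + qq * y)" for x y
    unfolding v using inv by algebra+
  have T: "hecke_bar (hecke_C a (hscale c (T w))) = hecke_C a (hecke_bar (hscale c (T w)))" for c w
    unfolding hecke_C_def[of a "hscale c (T w)"] hecke_bar_hscale_vpow hecke_bar_add
      hecke_bar_hecke_gen_T hecke_bar_hscale_T minus_minus
  proof (rule hecke_eqI)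
    fix y
    show "lk (hscale (vpow 1) (hecke_gen_inv a (hscale (laurent_bar c) (bar_T w)) +
        hscale (laurent_bar c) (bar_T w))) y = lk (hecke_C a (hscale (laurent_bar c) (bar_T w))) y"
      by (cases "up a y")
         (simp_all only: lookup_hecke_C lookup_hecke_gen_inv lookup_add lookup_hscale[of "vpow 1"]
           up down if_True if_False)
  qed
  have "hecke_bar (hecke_C a h) =
      hecke_bar (\<Sum>w\<in>Poly_Mapping.keys h. hecke_C a (hscale (lk h w) (T w)))"
    by (subst (1) hecke_expand[of h]) (simp add: linear_op_sum linear_op_hecke_C)
  also have "\<dots> = hecke_C a (hecke_bar (\<Sum>w\<in>Poly_Mapping.keys h. hscale (lk h w) (T w)))"
    by (simp add: hecke_bar_sum T linear_op_sum linear_op_hecke_C)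
  finally show ?thesis by (simp flip: hecke_expand)
qed

section \<open>Uniqueness of Kazhdan--Lusztig families\<close>

lemma lookup_laurent_of_qpoly:
  "Poly_Mapping.lookup (laurent_of_qpoly p) k =
     (if 0 \<le> k \<and> even k then coeff p (nat (k div 2)) else 0)"
proof -
  have "Poly_Mapping.lookup (laurent_of_qpoly p) k =
      (\<Sum>i\<le>degree p. if i = nat (k div 2) then if 0 \<le> k \<and> even k then coeff p i else 0 else 0)"
    unfolding laurent_of_qpoly_def lookup_sum lookup_single
    by (rule sum.cong) (auto simp: when_def elim!: evenE)
  also have "\<dots> = (if 0 \<le> k \<and> even k then coeff p (nat (k div 2)) else 0)"
    by (simp add: coeff_eq_0 sum.delta)
  finally show ?thesis .
qed

lemma laurent_of_qpoly_inject: "laurent_of_qpoly p = laurent_of_qpoly p' \<longleftrightarrow> p = p'"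
proof
  assume eq: "laurent_of_qpoly p = laurent_of_qpoly p'"
  have "coeff p i = coeff p' i" for i
    using lookup_laurent_of_qpoly[of p "2 * int i"] lookup_laurent_of_qpoly[of p' "2 * int i"]
    by (simp add: eq)
  then show "p = p'" by (rule poly_eqI)
qed simp

lemma lookup_laurent_of_qpoly_eq_0:
  assumes "2 * int (degree p) < k"
  shows "Poly_Mapping.lookup (laurent_of_qpoly p) k = 0"
proof (cases "even k")
  case True
  then have "degree p < nat (k div 2)" using assms by auto
  then show ?thesis by (simp add: lookup_laurent_of_qpoly coeff_eq_0)
qed (simp add: lookup_laurent_of_qpoly)

lemma lookup_kl_element:
  "lk (kl_element w p) y = vpow (- int (len w)) * (if y \<le> w then laurent_of_qpoly (p y) else 0)"
proof -
  have "(\<Sum>x | x \<le> w. laurent_of_qpoly (p x) * (if x = y then 1 else 0)) =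
      (\<Sum>x | x \<le> w. if x = y then laurent_of_qpoly (p x) else 0)"
    by (rule sum.cong) auto
  then show ?thesis
    by (simp add: kl_element_def lookup_sum lookup_T finite_le_weyl sum.delta)
qed

lemma bar_fixed_top_coefficient:
  assumes "hecke_bar h = h" and "\<And>x. lk h x \<noteq> 0 \<Longrightarrow> len x \<le> len y"
  shows "lk h y = vpow (- 2 * int (len y)) * laurent_bar (lk h y)"
proof -
  have "lk h y = (\<Sum>x\<in>Poly_Mapping.keys h. laurent_bar (lk h x) * lk (bar_T x) y)"
    by (subst assms(1)[symmetric])
       (simp add: hecke_bar_superset[of "Poly_Mapping.keys h"] lookup_sum)
  also have "\<dots> = (\<Sum>x\<in>Poly_Mapping.keys h. if x = y then laurent_bar (lk h y) * vpow (- 2 * int (len y)) else 0)"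
    using assms(2) bar_T_triangular by (intro sum.cong) (auto simp: in_keys_iff)
  also have "\<dots> = vpow (- 2 * int (len y)) * laurent_bar (lk h y)"
    by (simp add: sum.delta in_keys_iff mult.commute)
  finally show ?thesis .
qed

text \<open>At a longest \<open>y\<close> in the support of the difference, bar-invariance makes the
  difference of the two polynomials symmetric under the exponent map j -> 2 (l(w) - l(y)) - j. The
  degree bounds remove all exponents j \<ge> l(w) - l(y), and the symmetry removes the
  others.\<close>

lemma kl_family_unique:
  assumes p: "kl_family w p" and p': "kl_family w p'"
  shows "p = p'"
proof -
  define h where "h = kl_element w p - kl_element w p'"
  have bar: "hecke_bar h = h"
    using p p' by (simp add: h_def hecke_bar_diff kl_family_def)
  have h: "lk h y = vpow (- int (len w)) * (laurent_of_qpoly (p y) - laurent_of_qpoly (p' y))" for y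
    using p p' by (auto simp: h_def lookup_minus lookup_kl_element kl_family_def right_diff_distrib)
  have "h = 0"
  proof (rule ccontr)
    assume "h \<noteq> 0"
    then have "\<exists>y. y \<in> Poly_Mapping.keys h" by (metis hecke_eqI in_keys_iff lookup_zero)
    then obtain y where y: "y \<in> Poly_Mapping.keys h"
      and max: "\<And>x. x \<in> Poly_Mapping.keys h \<Longrightarrow> len x \<le> len y"
      using ex_has_greatest_nat[of "\<lambda>x. x \<in> Poly_Mapping.keys h" _ len "Suc (Max (len ` Poly_Mapping.keys h))"]
      by (metis Max_ge finite_imageI finite_keys image_eqI le_imp_less_Suc)
    define L where "L = laurent_of_qpoly (p y) - laurent_of_qpoly (p' y)"
    have "lk h y = vpow (- 2 * int (len y)) * laurent_bar (lk h y)"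
      using bar max by (intro bar_fixed_top_coefficient) (auto simp: in_keys_iff)
    then have "vpow (- int (len w)) * L = vpow (- 2 * int (len y)) * (vpow (int (len w)) * laurent_bar L)"
      by (simp add: h L_def laurent_bar_vpow_mult)
    then have "Poly_Mapping.lookup (vpow (- int (len w)) * L) (j - int (len w)) =
        Poly_Mapping.lookup (vpow (- 2 * int (len y)) * (vpow (int (len w)) * laurent_bar L)) (j - int (len w))" for j
      by simp
    then have sym: "Poly_Mapping.lookup L j = Poly_Mapping.lookup L (2 * (int (len w) - int (len y)) - j)" for j
      unfolding lookup_vpow_mult lookup_laurent_bar by (simp add: algebra_simps)
    have "y \<noteq> w" using y h[of w] p p' by (auto simp: in_keys_iff kl_family_def)
    moreover have "y \<le> w"
    proof (rule ccontr)
      assume "\<not> y \<le> w"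
      then have "p y = p' y" using p p' by (simp add: kl_family_def)
      then show False using y h[of y] by (simp add: in_keys_iff)
    qed
    ultimately have "y < w" by simp
    then have "2 * int (degree (p y)) \<le> int (len w) - int (len y) - 1"
      "2 * int (degree (p' y)) \<le> int (len w) - int (len y) - 1"
      using p p' by (simp_all add: kl_family_def)
    then have "Poly_Mapping.lookup L j = 0" if "int (len w) - int (len y) \<le> j" for j
      using that by (simp add: L_def lookup_minus lookup_laurent_of_qpoly_eq_0)
    then have "Poly_Mapping.lookup L j = 0" for j
      using sym[of j] by (cases "int (len w) - int (len y) \<le> j") auto
    then have "L = 0" by (simp add: poly_mapping_eq_iff fun_eq_iff)
    then show False using y h[of y] by (simp add: in_keys_iff L_def)
  qed
  then have "laurent_of_qpoly (p y) = laurent_of_qpoly (p' y)" for y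
    using h[of y] by simp
  then show ?thesis by (auto simp: laurent_of_qpoly_inject)
qed

lemma KL_eqI: "kl_family w p \<Longrightarrow> KL y w = p y"
  unfolding KL_def using kl_family_unique by (metis the_equality)

section \<open>Bar-invariant functions on the group\<close>

text \<open>For \<open>l = len w\<close> and \<open>F\<close> the KL polynomials of \<open>w\<close>
  this is bar-invariance of C_w. Keeping the normalisation apart lets \<open>F\<close> be a
  combination of indicator functions with powers of q.\<close>

definition bar_fixed :: "int \<Rightarrow> (weyl \<Rightarrow> laurent) \<Rightarrow> bool" where
  "bar_fixed l F \<longleftrightarrow> (\<exists>h. hecke_bar h = h \<and> (\<forall>y. lk h y = vpow (- l) * F y))"

lemma bar_fixed_zero: "bar_fixed l (\<lambda>_. 0)"
  unfolding bar_fixed_def using hecke_bar_sum[of "\<lambda>_. 0" "{}"] by (intro exI[of _ 0]) simp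

lemma bar_fixed_unit: "bar_fixed 0 (\<lambda>y. of_bool (y = 1))"
  unfolding bar_fixed_def using hecke_bar_hscale_T[of 1 1]
  by (intro exI[of _ "T 1"]) (auto simp: bar_T_1 lookup_T)

text \<open>Subtraction of a correction term of length \<open>k\<close>: brought to the
  normalisation of length \<open>l\<close> it acquires the factor q^j with j = (l - k)/2.\<close>

lemma bar_fixed_cancel:
  assumes "bar_fixed l H" "bar_fixed k G" "k = l - 2 * j" "\<And>y. H y = F y + vpow (2 * j) * G y"
  shows "bar_fixed l F"
proof -
  from assms obtain g h where g: "hecke_bar g = g" "\<And>y. lk g y = vpow (- l) * H y"
    and h: "hecke_bar h = h" "\<And>y. lk h y = vpow (- k) * G y"
    unfolding bar_fixed_def by blast
  have "vpow (- k) = vpow (- l) * vpow (2 * j)" by (simp add: vpow_mult assms(3))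
  then have "lk (g - h) y = vpow (- l) * F y" for y
    by (simp add: lookup_minus g h assms(4) distrib_left mult.assoc)
  then show ?thesis unfolding bar_fixed_def using g h by (metis hecke_bar_diff)
qed

lemma bar_fixed_C:
  assumes "bar_fixed l F"
    and "\<And>y. up a y \<Longrightarrow> R y = F y + qq * F (gn a * y) \<and> R (gn a * y) = F y + qq * F (gn a * y)"
  shows "bar_fixed (l + 1) R"
proof -
  from assms(1) obtain h where h: "hecke_bar h = h" "\<And>y. lk h y = vpow (- l) * F y"
    unfolding bar_fixed_def by blast
  have v: "vpow (- (l + 1)) = vpow (- 1) * vpow (- l)"
    by (simp add: vpow_mult algebra_simps)
  have "lk (hecke_C a h) y = vpow (- (l + 1)) * R y" for y
  proof (cases "up a y")
    case True
    then show ?thesis using assms(2)[of y] unfolding v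
      by (simp add: lookup_hecke_C h algebra_simps)
  next
    case False
    then show ?thesis using assms(2)[of "gn a * y"] unfolding v
      by (simp add: lookup_hecke_C h algebra_simps)
  qed
  then show ?thesis unfolding bar_fixed_def using h hecke_bar_hecke_C[of a h] by metis
qed

section \<open>Affine permutations\<close>

text \<open>The simple affine transposition exchanging i + 3k and i + 3k + 1 for every k.\<close>

definition swap3 :: "int \<Rightarrow> int \<Rightarrow> int" where
  "swap3 i v = (if (v - i) mod 3 = 0 then v + 1 else if (v - i) mod 3 = 1 then v - 1 else v)"

lemma swap3_simps [simp]:
  "swap3 i i = i + 1" "swap3 i (i + 1) = i" "swap3 i (i + 2) = i + 2"
  by (simp_all add: swap3_def)

lemma swap3_add_mult: "swap3 i (v + 3 * k) = swap3 i v + 3 * k"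
proof -
  have "(v + 3 * k - i) mod 3 = (v - i) mod 3" by presburger
  then show ?thesis by (simp add: swap3_def)
qed

lemma swap3_add3: "swap3 i (v + 3) = swap3 i v + 3"
  using swap3_add_mult[of i v 1] by simp

lemma swap3_cong: "(i - j) mod 3 = 0 \<Longrightarrow> swap3 i = swap3 j"
proof (rule ext)
  fix v assume "(i - j) mod 3 = 0"
  then have "(v - i) mod 3 = (v - j) mod 3" by presburger
  then show "swap3 i v = swap3 j v" by (simp add: swap3_def)
qed

lemma residue_cases:
  fixes v i :: int
  obtains k r where "v = r + 3 * k" "r = i \<or> r = i + 1 \<or> r = i + 2"
proof -
  have "v = (i + (v - i) mod 3) + 3 * ((v - i) div 3)" by simp
  moreover have "(v - i) mod 3 = 0 \<or> (v - i) mod 3 = 1 \<or> (v - i) mod 3 = 2" by presburger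
  ultimately show ?thesis using that by (metis add.right_neutral)
qed

lemma swap3_swap3: "swap3 i (swap3 i v) = v"
proof -
  obtain k r where "v = r + 3 * k" "r = i \<or> r = i + 1 \<or> r = i + 2" by (rule residue_cases)
  then show ?thesis by (auto simp: swap3_add_mult)
qed

lemma swap3_mod_eq_iff: "(swap3 i v - swap3 i w) mod 3 = 0 \<longleftrightarrow> (v - w) mod 3 = 0"
proof -
  have imp: "(swap3 i v - swap3 i w) mod 3 = 0" if vw: "(v - w) mod 3 = 0" for v w
  proof -
    obtain k where "v = w + 3 * k" using vw by (metis add.commute diff_add_cancel mod_0_imp_dvd dvdE)
    then show ?thesis by (simp add: swap3_add_mult)
  qed
  show ?thesis using imp[of v w] imp[of "swap3 i v" "swap3 i w"] by (auto simp: swap3_swap3)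
qed

lemma swap3_braid:
  assumes "(i - j) mod 3 \<noteq> 0"
  shows "swap3 i (swap3 j (swap3 i v)) = swap3 j (swap3 i (swap3 j v))"
proof -
  obtain k r where v: "v = r + 3 * k" "r = i \<or> r = i + 1 \<or> r = i + 2" by (rule residue_cases)
  have "(j - (i + 1)) mod 3 = 0 \<or> (j - (i + 2)) mod 3 = 0" using assms by presburger
  then have "swap3 j = swap3 (i + 1) \<or> swap3 j = swap3 (i + 2)" using swap3_cong[of j "i + 1"] swap3_cong[of j "i + 2"] by auto
  moreover have "swap3 i (swap3 j (swap3 i r)) = swap3 j (swap3 i (swap3 j r))"
    if "j = i + 1 \<or> j = i + 2" for j
    using that v(2) by (elim disjE) (simp_all add: swap3_def)
  ultimately show ?thesis by (auto simp: v(1) swap3_add_mult)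
qed

text \<open>All identifications of the generators with residues modulo 3 are kept available: the
  given word dictates one of them, and the induction rotates labels.\<close>

definition labelling :: "(gen \<Rightarrow> int) \<Rightarrow> bool" where
  "labelling lab \<longleftrightarrow> (\<forall>a b. a \<noteq> b \<longrightarrow> (lab a - lab b) mod 3 \<noteq> 0)"

lemma labelling_surj:
  assumes "labelling lab" obtains a where "(n - lab a) mod 3 = 0"
proof -
  have "(lab gen_r - lab gen_s) mod 3 \<noteq> 0" "(lab gen_r - lab gen_t) mod 3 \<noteq> 0"
    "(lab gen_s - lab gen_t) mod 3 \<noteq> 0"
    using assms by (auto simp: labelling_def)
  then have "(n - lab gen_r) mod 3 = 0 \<or> (n - lab gen_s) mod 3 = 0 \<or> (n - lab gen_t) mod 3 = 0"
    by presburger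
  then show ?thesis by (elim disjE) (rule that, assumption)+
qed

lemma labelling_rotate: "labelling lab \<Longrightarrow> labelling (\<lambda>a. lab a + 1)"
  by (simp add: labelling_def)

fun perm_word :: "(gen \<Rightarrow> int) \<Rightarrow> gen list \<Rightarrow> int \<Rightarrow> int" where
  "perm_word lab [] v = v"
| "perm_word lab (a # xs) v = perm_word lab xs (swap3 (lab a) v)"

lemma perm_word_append: "perm_word lab (xs @ ys) v = perm_word lab ys (perm_word lab xs v)"
  by (induction xs arbitrary: v) auto

lemma perm_word_add3: "perm_word lab xs (v + 3) = perm_word lab xs v + 3"
  by (induction xs arbitrary: v) (auto simp: swap3_add3)

lemma perm_word_mod_eq_iff:
  "(perm_word lab xs v - perm_word lab xs w) mod 3 = 0 \<longleftrightarrow> (v - w) mod 3 = 0"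
  by (induction xs arbitrary: v w) (auto simp: swap3_mod_eq_iff)

lemma perm_word_sum:
  "perm_word lab xs v + perm_word lab xs (v + 1) + perm_word lab xs (v + 2) = 3 * v + 3"
proof (induction xs arbitrary: v)
  case (Cons a xs)
  have shift: "perm_word lab xs (v - 1) = perm_word lab xs (v + 2) - 3" for v
    using perm_word_add3[of lab xs "v - 1"] by (simp add: add.commute)
  have shift': "perm_word lab xs (v + 3) = perm_word lab xs v + 3" for v
    by (rule perm_word_add3)
  have "(v - lab a) mod 3 = 0 \<or> (v - lab a) mod 3 = 1 \<or> (v - lab a) mod 3 = 2" by presburger
  then consider "(v - lab a) mod 3 = 0" | "(v - lab a) mod 3 = 1" | "(v - lab a) mod 3 = 2" by metis
  then show ?case
  proof cases
    case 1
    then have "swap3 (lab a) v = v + 1" "swap3 (lab a) (v + 1) = v" "swap3 (lab a) (v + 2) = v + 2"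
      by (simp_all add: swap3_def) presburger+
    then show ?thesis using Cons[of v] by simp
  next
    case 2
    then have "swap3 (lab a) v = v - 1" "swap3 (lab a) (v + 1) = v + 1" "swap3 (lab a) (v + 2) = v + 3"
      by (simp_all add: swap3_def) presburger+
    then show ?thesis using Cons[of v] shift[of v] shift'[of v] by simp
  next
    case 3
    then have "swap3 (lab a) v = v" "swap3 (lab a) (v + 1) = v + 2" "swap3 (lab a) (v + 2) = v + 1"
      by (simp_all add: swap3_def) presburger+
    then show ?thesis using Cons[of v] by simp
  qed
qed simp

lemma cox_eq_perm_word:
  assumes "labelling lab"
  shows "cox_eq xs ys \<Longrightarrow> perm_word lab xs v = perm_word lab ys v"
proof (induction arbitrary: v rule: cox_eq.induct)
  case (cox_cube a b)
  then have "(lab b - lab a) mod 3 \<noteq> 0" using assms by (simp add: labelling_def)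
  from swap3_braid[OF this, of "swap3 (lab a) (swap3 (lab b) (swap3 (lab a) v))"]
  show ?case by (simp add: swap3_swap3)
next
  case (cox_trans xs ys zs)
  then show ?case by metis
qed (simp_all add: perm_word_append swap3_swap3)

text \<open>The inverse of \<open>y\<close>, viewed as an affine permutation.\<close>

definition aperm :: "(gen \<Rightarrow> int) \<Rightarrow> weyl \<Rightarrow> int \<Rightarrow> int" where
  "aperm lab y = perm_word lab (SOME xs. word xs = y)"

lemma aperm_word: "labelling lab \<Longrightarrow> aperm lab (word xs) = perm_word lab xs"
proof (rule ext)
  fix v assume "labelling lab"
  moreover have "word (SOME ys. word ys = word xs) = word xs" by (rule someI) simp
  ultimately show "aperm lab (word xs) v = perm_word lab xs v"
    unfolding aperm_def by (intro cox_eq_perm_word) (simp_all add: word_eq_iff)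
qed

lemma aperm_one [simp]: "labelling lab \<Longrightarrow> aperm lab 1 v = v"
  using aperm_word[of lab "[]"] by (simp add: word_Nil)

lemma aperm_gn_mult: "labelling lab \<Longrightarrow> aperm lab (gn a * y) v = aperm lab y (swap3 (lab a) v)"
proof -
  assume lab: "labelling lab"
  obtain xs where "y = word xs" using word_surj by metis
  then show ?thesis
    using aperm_word[OF lab, of "a # xs"] aperm_word[OF lab, of xs] word_Cons[of a xs] by simp
qed

lemma aperm_add3: "aperm lab y (v + 3) = aperm lab y v + 3"
  unfolding aperm_def by (rule perm_word_add3)

lemma aperm_mod_eq_iff: "(aperm lab y v - aperm lab y w) mod 3 = 0 \<longleftrightarrow> (v - w) mod 3 = 0"
  unfolding aperm_def by (rule perm_word_mod_eq_iff)

lemma aperm_sum: "aperm lab y v + aperm lab y (v + 1) + aperm lab y (v + 2) = 3 * v + 3"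
  unfolding aperm_def by (rule perm_word_sum)

lemma aperm_shift: "(v - w) mod 3 = 0 \<Longrightarrow> aperm lab y v = aperm lab y w + (v - w)"
proof -
  have nat: "aperm lab y (x + 3 * int k) = aperm lab y x + 3 * int k" for x k
  proof (induction k)
    case (Suc k)
    then show ?case using aperm_add3[of lab y "x + 3 * int k"] by (simp add: algebra_simps)
  qed simp
  assume "(v - w) mod 3 = 0"
  then obtain k where k: "v - w = 3 * k" by auto
  show ?thesis
  proof (cases "0 \<le> k")
    case True
    then show ?thesis using nat[of w "nat k"] k by (simp add: algebra_simps)
  next
    case False
    then show ?thesis using nat[of v "nat (- k)"] k by (simp add: algebra_simps)
  qed
qed

text \<open>
  If \<open>a\<close> is not a left descent of \<open>y\<close>, strip from \<open>y\<close> its maximal left factor in a suitable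
  rank two parabolic subgroup containing \<open>a\<close>.
\<close>

lemma aperm_less_if_up:
  assumes lab: "labelling lab"
  shows "up a y \<Longrightarrow> aperm lab y (lab a) < aperm lab y (lab a + 1)"
proof (induction "len y" arbitrary: a y rule: less_induct)
  case less
  show ?case
  proof (cases "y = 1")
    case True
    then show ?thesis using lab by simp
  next
    case False
    then obtain b where b: "len y = Suc (len (gn b * y))" by (rule obtain_left_descent)
    define z where "z = gn b * y"
    have y: "y = gn b * z" and upb: "up b z" and lz: "len y = Suc (len z)"
      using b by (simp_all add: z_def)
    have "a \<noteq> b" using less.prems b by auto
    then have "(lab b - lab a) mod 3 \<noteq> 0" using lab by (simp add: labelling_def)
    then have "(lab b - (lab a + 1)) mod 3 = 0 \<or> (lab b - (lab a - 1)) mod 3 = 0" by presburger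
    then consider (suc) "(lab b - (lab a + 1)) mod 3 = 0" | (pre) "(lab b - (lab a - 1)) mod 3 = 0"
      by metis
    note j = this
    have swap: "swap3 (lab b) = swap3 i" if "(lab b - i) mod 3 = 0" for i
      using that by (rule swap3_cong)
    have shift: "aperm lab x i < aperm lab x (i + 1)"
      if "aperm lab x (lab b) < aperm lab x (lab b + 1)" "(lab b - i) mod 3 = 0" for x i
      using that aperm_shift[of "lab b" i lab x] aperm_shift[of "lab b + 1" "i + 1" lab x] by simp
    show ?thesis
    proof (cases "up a z")
      case True
      \<comment> \<open>The two ascents make three consecutive values of \<open>z\<close>
        increasing; the swap belonging to \<open>b\<close> leaves the pair at \<open>a\<close> in
        order.\<close>
      have "aperm lab z (lab a) < aperm lab z (lab a + 1)"
        "aperm lab z (lab b) < aperm lab z (lab b + 1)"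
        using less.hyps[of z] lz True upb by auto
      show ?thesis
        using j
      proof cases
        case suc
        then show ?thesis
          using \<open>aperm lab z (lab a) < _\<close> shift[OF \<open>aperm lab z (lab b) < _\<close> suc]
          by (simp add: y aperm_gn_mult[OF lab] swap[OF suc] swap3_def)
      next
        case pre
        then show ?thesis
          using \<open>aperm lab z (lab a) < _\<close> shift[OF \<open>aperm lab z (lab b) < _\<close> pre]
          by (simp add: y aperm_gn_mult[OF lab] swap[OF pre] swap3_def)
      qed
    next
      case False
      define x where "x = gn a * z"
      have z: "z = gn a * x" and upa: "up a x" and lx: "len z = Suc (len x)"
        using False len_gn_mult[of a z] by (auto simp: x_def)
      \<comment> \<open>Otherwise the braid relation gives
        \<open>gn a * y = gn b * (gn a * (gn b * x))\<close>, of length at most l(y) - 1, against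
        \<open>up a y\<close>.\<close>
      have "up b x"
      proof (rule ccontr)
        assume "\<not> up b x"
        then have "len x = Suc (len (gn b * x))" using len_gn_mult[of b x] by auto
        moreover have "gn a * y = gn b * (gn a * (gn b * x))" if "x = gn b * x'" for x'
          by (simp add: y z that) (use gn_braid[OF \<open>a \<noteq> b\<close>] in simp)
        then have "gn a * y = gn b * (gn a * (gn b * x))" by (metis gn_gn_left)
        then have "len (gn a * y) \<le> Suc (Suc (len (gn b * x)))"
          using len_gn_mult_le[of b "gn a * (gn b * x)"] len_gn_mult_le[of a "gn b * x"] by simp
        ultimately show False using less.prems lz lx by simp
      qed
      then have ab: "aperm lab x (lab a) < aperm lab x (lab a + 1)"
        "aperm lab x (lab b) < aperm lab x (lab b + 1)"
        using less.hyps[of x] lz lx upa by auto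
      show ?thesis
        using j
      proof cases
        case suc
        then show ?thesis using ab shift[OF ab(2) suc]
          by (simp add: y z aperm_gn_mult[OF lab] swap[OF suc] swap3_def)
      next
        case pre
        then show ?thesis using ab shift[OF ab(2) pre]
          by (simp add: y z aperm_gn_mult[OF lab] swap[OF pre] swap3_def)
      qed
    qed
  qed
qed

lemma up_iff_aperm_less:
  assumes lab: "labelling lab" and i: "(i - lab a) mod 3 = 0"
  shows "up a y \<longleftrightarrow> aperm lab y i < aperm lab y (i + 1)"
proof -
  have "aperm lab y i = aperm lab y (lab a) + (i - lab a)"
    "aperm lab y (i + 1) = aperm lab y (lab a + 1) + (i - lab a)"
    using i aperm_shift[of i "lab a" lab y] aperm_shift[of "i + 1" "lab a + 1" lab y] by simp_all
  moreover have "up a y \<longleftrightarrow> aperm lab y (lab a) < aperm lab y (lab a + 1)"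
    using aperm_less_if_up[OF lab, of y a] aperm_less_if_up[OF lab, of "gn a * y" a]
    by (cases "up a y") (auto simp: aperm_gn_mult[OF lab])
  ultimately show ?thesis by simp
qed

lemma aperm_gn_mult_window:
  assumes "labelling lab" and "(i - lab a) mod 3 = 0"
  shows "aperm lab (gn a * y) i = aperm lab y (i + 1)"
    "aperm lab (gn a * y) (i + 1) = aperm lab y i"
    "aperm lab (gn a * y) (i + 2) = aperm lab y (i + 2)"
proof -
  have "swap3 (lab a) = swap3 i"
    using swap3_cong[of i "lab a"] assms(2) by simp
  then show "aperm lab (gn a * y) i = aperm lab y (i + 1)"
    "aperm lab (gn a * y) (i + 1) = aperm lab y i"
    "aperm lab (gn a * y) (i + 2) = aperm lab y (i + 2)"
    using assms(1) by (simp_all add: aperm_gn_mult)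
qed

lemma aperm_rotate: "labelling lab \<Longrightarrow> aperm (\<lambda>a. lab a + 1) y (v + 1) = aperm lab y v + 1"
proof -
  assume lab: "labelling lab"
  obtain xs where "y = word xs" using word_surj by metis
  moreover have "perm_word (\<lambda>a. lab a + 1) xs (v + 1) = perm_word lab xs v + 1" for v
  proof (induction xs arbitrary: v)
    case (Cons a xs)
    have "swap3 (lab a + 1) (v + 1) = swap3 (lab a) v + 1" by (simp add: swap3_def)
    then show ?case using Cons by simp
  qed simp
  ultimately show ?thesis using lab labelling_rotate[OF lab] by (simp add: aperm_word)
qed

lemma eq_1_if_aperm_sorted:
  assumes lab: "labelling lab"
    and "aperm lab y 1 < aperm lab y 2" "aperm lab y 2 < aperm lab y 3" "aperm lab y 3 < aperm lab y 1 + 3"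
  shows "y = 1"
proof (rule ccontr)
  assume "y \<noteq> 1"
  then obtain a where a: "len y = Suc (len (gn a * y))" by (rule obtain_left_descent)
  have "aperm lab y 4 = aperm lab y 1 + 3" using aperm_add3[of lab y 1] by simp
  moreover have "(1 - lab a) mod 3 = 0 \<or> (2 - lab a) mod 3 = 0 \<or> (3 - lab a) mod 3 = 0"
    by presburger
  moreover have "up a y \<longleftrightarrow> aperm lab y 1 < aperm lab y 2" if "(1 - lab a) mod 3 = 0"
    using up_iff_aperm_less[OF lab that, of y] by simp
  moreover have "up a y \<longleftrightarrow> aperm lab y 2 < aperm lab y 3" if "(2 - lab a) mod 3 = 0"
    using up_iff_aperm_less[OF lab that, of y] by simp
  moreover have "up a y \<longleftrightarrow> aperm lab y 3 < aperm lab y 4" if "(3 - lab a) mod 3 = 0"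
    using up_iff_aperm_less[OF lab that, of y] by simp
  ultimately have "up a y" using assms(2-) by metis
  then show False using a by simp
qed

section \<open>The Kazhdan--Lusztig elements of the periodic words\<close>

text \<open>
  Let \<open>x\<^sub>n\<close> be the word of length \<open>n\<close> whose letter at distance \<open>k\<close> from its end (counting from 1)
  has label \<open>k\<close> modulo 3, and let \<open>g\<close> be the affine permutation of \<open>y\<close>. The Kazhdan--Lusztig
  polynomial of \<open>y\<close> and \<open>x\<^sub>n\<close> is the sum of 1 if \<open>supp_x n g\<close> and of \<open>q\<close> if \<open>supp_xq n g\<close>; these
  conditions were found by computing small cases. The sets \<open>supp_t i c\<close> with \<open>c\<close> not congruent
  to 1, and \<open>supp_z m\<close> together with \<open>q\<close> times a set \<open>supp_t\<close>, describe in the same way the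
  elements \<open>a b a x\<^sub>k\<close>, where \<open>a\<close> and \<open>b\<close> differ from the first letter of \<open>x\<^sub>k\<close>, for even
  and odd \<open>k\<close> respectively, up to a rotation of the labels.
\<close>

definition supp_x :: "int \<Rightarrow> (int \<Rightarrow> int) \<Rightarrow> bool" where
  "supp_x n g \<longleftrightarrow> 2 * (g n - n) \<le> n + 1 \<and> 2 * (g (n + 1) - n) \<le> n + 1 \<and>
     2 * (g (n + 2) - n) \<le> n + 4 \<and> (n = 1 \<or> 4 \<le> g (n + 2))"

definition supp_xq :: "int \<Rightarrow> (int \<Rightarrow> int) \<Rightarrow> bool" where
  "supp_xq n g \<longleftrightarrow> 2 * (g n - n) \<le> n - 2 \<and> 2 * (g (n + 1) - n) \<le> n - 2 \<and>
     2 * (g (n + 2) - n) \<le> n + 1"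

definition supp_t :: "int \<Rightarrow> int \<Rightarrow> (int \<Rightarrow> int) \<Rightarrow> bool" where
  "supp_t i c g \<longleftrightarrow> g i \<le> c \<and> g (i + 1) \<le> c \<and> g (i + 2) \<le> c"

definition supp_z :: "int \<Rightarrow> (int \<Rightarrow> int) \<Rightarrow> bool" where
  "supp_z m g \<longleftrightarrow> supp_t (2 * m + 2) (3 * m + 5) g \<and>
     1 \<le> g (2 * m + 2) \<and> 1 \<le> g (2 * m + 3) \<and> 1 \<le> g (2 * m + 4)"

definition kl_x :: "(gen \<Rightarrow> int) \<Rightarrow> int \<Rightarrow> weyl \<Rightarrow> laurent" where
  "kl_x lab n y = of_bool (supp_x n (aperm lab y)) + qq * of_bool (supp_xq n (aperm lab y))"

definition kl_t :: "(gen \<Rightarrow> int) \<Rightarrow> int \<Rightarrow> int \<Rightarrow> weyl \<Rightarrow> laurent" where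
  "kl_t lab i c y = of_bool (supp_t i c (aperm lab y))"

definition kl_z :: "(gen \<Rightarrow> int) \<Rightarrow> int \<Rightarrow> weyl \<Rightarrow> laurent" where
  "kl_z lab m y = of_bool (supp_z m (aperm lab y)) +
     qq * of_bool (supp_t (2 * m + 2) (3 * m + 3) (aperm lab y))"

text \<open>
  \<open>g\<close> and \<open>h\<close> are the affine permutations of \<open>y\<close> and \<open>a y\<close>, where \<open>a\<close> has label \<open>i\<close> modulo 3
  and is not a left descent of \<open>y\<close>.
\<close>

definition swapped :: "int \<Rightarrow> (int \<Rightarrow> int) \<Rightarrow> (int \<Rightarrow> int) \<Rightarrow> bool" where
  "swapped i g h \<longleftrightarrow> g i < g (i + 1) \<and> g i + g (i + 1) + g (i + 2) = 3 * i + 3 \<and>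
     g i mod 3 \<noteq> g (i + 1) mod 3 \<and> g i mod 3 \<noteq> g (i + 2) mod 3 \<and> g (i + 1) mod 3 \<noteq> g (i + 2) mod 3 \<and>
     h i = g (i + 1) \<and> h (i + 1) = g i \<and> h (i + 2) = g (i + 2) \<and>
     (\<forall>v. g (v + 3) = g v + 3 \<and> h (v + 3) = h v + 3)"

lemma swapped_aperm:
  assumes lab: "labelling lab" and i: "(i - lab a) mod 3 = 0" and "up a y"
  shows "swapped i (aperm lab y) (aperm lab (gn a * y))"
proof -
  have "aperm lab y v mod 3 \<noteq> aperm lab y w mod 3" if "(v - w) mod 3 \<noteq> 0" for v w
    using aperm_mod_eq_iff[of lab y v w] that by (metis mod_diff_cong diff_self mod_0)
  from this[of i "i + 1"] this[of i "i + 2"] this[of "i + 1" "i + 2"] show ?thesis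
    using assms up_iff_aperm_less[OF lab i, of y] aperm_gn_mult_window[OF lab i, of y]
      aperm_sum[of lab y i] by (simp add: swapped_def aperm_add3)
qed

lemma swapped_shift:
  assumes "swapped i g h"
  shows "g (i - 1) = g (i + 2) - 3" "h (i - 1) = g (i + 2) - 3" "g (i + 3) = g i + 3" "h (i + 3) = g (i + 1) + 3"
    "g (i - 2) = g (i + 1) - 3" "h (i - 2) = g i - 3" "g (i - 3) = g i - 3" "h (i - 3) = g (i + 1) - 3"
    "g (i - 4) = g (i + 2) - 6" "h (i - 4) = g (i + 2) - 6"
proof -
  have g: "g (v + 3) = g v + 3" and h: "h (v + 3) = h v + 3" for v
    using assms by (simp_all add: swapped_def)
  have w: "h i = g (i + 1)" "h (i + 1) = g i" "h (i + 2) = g (i + 2)"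
    using assms by (simp_all add: swapped_def)
  have s: "i - 1 + 3 = i + 2" "i - 2 + 3 = i + 1" "i - 3 + 3 = i" "i - 4 + 3 = i - 1" by simp_all
  show "g (i - 1) = g (i + 2) - 3" "h (i - 1) = g (i + 2) - 3" "g (i + 3) = g i + 3" "h (i + 3) = g (i + 1) + 3"
    "g (i - 2) = g (i + 1) - 3" "h (i - 2) = g i - 3" "g (i - 3) = g i - 3" "h (i - 3) = g (i + 1) - 3"
    "g (i - 4) = g (i + 2) - 6" "h (i - 4) = g (i + 2) - 6"
    using g[of "i - 1"] h[of "i - 1"] g[of i] h[of i] g[of "i - 2"] h[of "i - 2"] g[of "i - 3"] h[of "i - 3"]
      g[of "i - 4"] h[of "i - 4"] w unfolding s by simp_all
qed

section \<open>Support conditions by parity, and their behaviour under one generator\<close>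

lemma supp_x_even:
  "supp_x (2 * m) g \<longleftrightarrow>
     g (2 * m) \<le> 3 * m \<and> g (2 * m + 1) \<le> 3 * m \<and> g (2 * m + 2) \<le> 3 * m + 2 \<and> 4 \<le> g (2 * m + 2)"
  unfolding supp_x_def by auto presburger

lemma supp_x_odd:
  "supp_x (2 * m + 1) g \<longleftrightarrow>
     g (2 * m + 1) \<le> 3 * m + 2 \<and> g (2 * m + 2) \<le> 3 * m + 2 \<and> g (2 * m + 3) \<le> 3 * m + 3 \<and>
     (m = 0 \<or> 4 \<le> g (2 * m + 3))"
  unfolding supp_x_def by (auto simp: add.assoc)

lemma supp_xq_even:
  "supp_xq (2 * m) g \<longleftrightarrow>
     g (2 * m) \<le> 3 * m - 1 \<and> g (2 * m + 1) \<le> 3 * m - 1 \<and> g (2 * m + 2) \<le> 3 * m"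
  unfolding supp_xq_def by auto

lemma supp_xq_odd:
  "supp_xq (2 * m + 1) g \<longleftrightarrow>
     g (2 * m + 1) \<le> 3 * m \<and> g (2 * m + 2) \<le> 3 * m \<and> g (2 * m + 3) \<le> 3 * m + 2"
  unfolding supp_xq_def by (auto simp: add.assoc)

text \<open>The step from x_2m to x_(2m+1). The two \<open>supp_t\<close> sets with bounds
  \<open>3 * m\<close> and \<open>3 * m - 1\<close> are the corrections of lengths 2m - 1 and 2m -
  3, entering with q and q^2.\<close>

lemma supp_odd:
  assumes "swapped (2 * m + 1) g h" "1 \<le> m"
  shows "(supp_x (2 * m + 1) g \<longleftrightarrow> supp_x (2 * m) g) \<and>
    (supp_x (2 * m + 1) h \<longleftrightarrow> supp_x (2 * m) g) \<and>
    (supp_xq (2 * m + 1) h \<longleftrightarrow> supp_xq (2 * m + 1) g) \<and>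
    (supp_t (2 * m) (3 * m) h \<longleftrightarrow> supp_t (2 * m) (3 * m) g) \<and>
    (supp_t (2 * m) (3 * m - 1) h \<longleftrightarrow> supp_t (2 * m) (3 * m - 1) g) \<and>
    (supp_xq (2 * m) h \<longleftrightarrow> supp_t (2 * m) (3 * m - 1) g) \<and>
    (supp_x (2 * m) h \<and> supp_xq (2 * m) g \<longleftrightarrow> supp_xq (2 * m + 1) g \<and> supp_t (2 * m) (3 * m) g) \<and>
    (supp_x (2 * m) h \<or> supp_xq (2 * m) g \<longleftrightarrow> supp_xq (2 * m + 1) g \<or> supp_t (2 * m) (3 * m) g)"
proof -
  obtain A B C where w: "g (2 * m + 1) = A" "g (2 * m + 2) = B" "g (2 * m + 3) = C" "g (2 * m) = C - 3"
    "h (2 * m + 1) = B" "h (2 * m + 2) = A" "h (2 * m + 3) = C" "h (2 * m) = C - 3"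
    and f: "A < B" "A + B + C = 6 * m + 6" "A mod 3 \<noteq> B mod 3"
    using assms(1) swapped_shift(1,2)[OF assms(1)] by (auto simp: swapped_def algebra_simps)
  \<comment> \<open>The boundary case \<open>C = 3 * m + 3\<close>: there \<open>A = 3\<close>,
    \<open>B = 3 * m\<close> would satisfy the \<open>supp_t\<close> condition but violate the bound
    \<open>4 \<le> A\<close> from \<open>supp_x (2 * m) h\<close>.\<close>
  have "\<not> (A = 3 \<and> B = 3 * m)" using f(3) by auto
  note f' = f(1,2) this assms(2)
  show ?thesis
    unfolding supp_x_even supp_x_odd supp_xq_even supp_xq_odd supp_t_def w
    using f' by (intro conjI) (smt (verit))+
qed

text \<open>The step from x_(2m-1) to x_2m. One correction of length 2m - 2 suffices, as
  \<open>supp_z (m - 3)\<close> and q times the \<open>supp_t\<close> set are the two parts of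
  \<open>kl_z lab (m - 3)\<close>.\<close>

lemma supp_even:
  assumes "swapped (2 * m) g h" "2 \<le> m"
  shows "(supp_x (2 * m) g \<longleftrightarrow> supp_x (2 * m - 1) g) \<and>
    (supp_x (2 * m) h \<longleftrightarrow> supp_x (2 * m - 1) g) \<and>
    (supp_xq (2 * m) h \<longleftrightarrow> supp_xq (2 * m) g) \<and>
    (supp_z (m - 3) h \<longleftrightarrow> supp_z (m - 3) g) \<and>
    (supp_t (2 * m - 4) (3 * m - 6) h \<longleftrightarrow> supp_t (2 * m - 4) (3 * m - 6) g) \<and>
    (supp_xq (2 * m - 1) h \<longleftrightarrow> supp_t (2 * m - 4) (3 * m - 6) g) \<and>
    (supp_x (2 * m - 1) h \<and> supp_xq (2 * m - 1) g \<longleftrightarrow> supp_xq (2 * m) g \<and> supp_z (m - 3) g) \<and>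
    (supp_x (2 * m - 1) h \<or> supp_xq (2 * m - 1) g \<longleftrightarrow> supp_xq (2 * m) g \<or> supp_z (m - 3) g)"
proof -
  obtain A B C where w: "g (2 * m) = A" "g (2 * m + 1) = B" "g (2 * m + 2) = C"
    "h (2 * m) = B" "h (2 * m + 1) = A" "h (2 * m + 2) = C" "g (2 * m - 1) = C - 3" "h (2 * m - 1) = C - 3"
    "g (2 * m - 2) = B - 3" "g (2 * m - 3) = A - 3" "g (2 * m - 4) = C - 6"
    "h (2 * m - 2) = A - 3" "h (2 * m - 3) = B - 3" "h (2 * m - 4) = C - 6"
    and f: "A < B" "A + B + C = 6 * m + 3"
    using assms(1) swapped_shift[OF assms(1)] by (auto simp: swapped_def algebra_simps)
  have n: "2 * m - 1 = 2 * (m - 1) + 1" "2 * (m - 1) + 2 = 2 * m" "2 * (m - 1) + 3 = 2 * m + 1"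
    "2 * m - 4 + 1 = 2 * m - 3" "2 * m - 4 + 2 = 2 * m - 2" "2 * (m - 3) + 2 = 2 * m - 4"
    "2 * (m - 3) + 3 = 2 * m - 3" "2 * (m - 3) + 4 = 2 * m - 2" by simp_all
  note w' = w[unfolded n(1)]
  show ?thesis
    unfolding n(1) supp_x_even supp_x_odd supp_xq_even supp_xq_odd supp_z_def supp_t_def n(2-) w'
    using f assms(2) by (intro conjI) (smt (verit))+
qed

text \<open>Multiplying x_(2m+2) by the letter labelled 2m + 1, not by its periodic successor,
  creates the initial factor with labels 2m + 1, 2m + 2, 2m + 1 and hence two left descents.\<close>

lemma supp_t_step:
  assumes "swapped (2 * m + 1) g h" "0 \<le> m"
  shows "(supp_t (2 * m + 1) (3 * m + 3) g \<longleftrightarrow> supp_x (2 * m + 2) g) \<and>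
    (supp_t (2 * m + 1) (3 * m + 3) h \<longleftrightarrow> supp_x (2 * m + 2) g) \<and>
    (supp_t (2 * m + 1) (3 * m + 2) h \<longleftrightarrow> supp_t (2 * m + 1) (3 * m + 2) g) \<and>
    (supp_x (2 * m + 1) h \<longleftrightarrow> supp_x (2 * m + 1) g) \<and>
    (supp_xq (2 * m + 1) h \<longleftrightarrow> supp_xq (2 * m + 1) g) \<and>
    (supp_xq (2 * m + 2) h \<longleftrightarrow> supp_xq (2 * m + 1) g) \<and>
    (supp_x (2 * m + 2) h \<and> supp_xq (2 * m + 2) g \<longleftrightarrow> supp_x (2 * m + 1) g \<and> supp_t (2 * m + 1) (3 * m + 2) g) \<and>
    (supp_x (2 * m + 2) h \<or> supp_xq (2 * m + 2) g \<longleftrightarrow> supp_x (2 * m + 1) g \<or> supp_t (2 * m + 1) (3 * m + 2) g)"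
proof -
  obtain A B C where w: "g (2 * m + 1) = A" "g (2 * m + 2) = B" "g (2 * m + 3) = C" "g (2 * m + 4) = A + 3"
    "h (2 * m + 1) = B" "h (2 * m + 2) = A" "h (2 * m + 3) = C" "h (2 * m + 4) = B + 3"
    and f: "A < B" "A + B + C = 6 * m + 6" "B mod 3 \<noteq> C mod 3"
    using assms(1) swapped_shift[OF assms(1)] by (auto simp: swapped_def algebra_simps)
  have n: "2 * m + 2 = 2 * (m + 1)" "2 * (m + 1) + 1 = 2 * m + 3" "2 * (m + 1) + 2 = 2 * m + 4"
    "2 * m + 1 + 1 = 2 * (m + 1)" "2 * m + 1 + 2 = 2 * m + 3" by simp_all
  note w' = w[unfolded n(1)]
  \<comment> \<open>Excludes \<open>A = 0\<close>, \<open>B = C = 3 * m + 3\<close>, which would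
    separate \<open>supp_t\<close> from the lower bound in \<open>supp_x\<close>.\<close>
  have "B \<noteq> C" using f(3) by auto
  note f' = f(1,2) this assms(2)
  show ?thesis
    unfolding n(1) supp_x_even supp_x_odd supp_xq_even supp_xq_odd supp_t_def n w'
    using f' by (intro conjI) (smt (verit))+
qed

lemma supp_z_step:
  assumes "swapped (2 * m + 2) g h" "0 \<le> m"
  shows "(supp_z m g \<longleftrightarrow> supp_x (2 * m + 3) g) \<and>
    (supp_z m h \<longleftrightarrow> supp_x (2 * m + 3) g) \<and>
    (supp_t (2 * m + 2) (3 * m + 3) h \<longleftrightarrow> supp_t (2 * m + 2) (3 * m + 3) g) \<and>
    (supp_x (2 * m + 2) h \<longleftrightarrow> supp_x (2 * m + 2) g) \<and>
    (supp_xq (2 * m + 2) h \<longleftrightarrow> supp_xq (2 * m + 2) g) \<and>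
    (supp_xq (2 * m + 3) h \<longleftrightarrow> supp_xq (2 * m + 2) g) \<and>
    (supp_x (2 * m + 3) h \<and> supp_xq (2 * m + 3) g \<longleftrightarrow> supp_t (2 * m + 2) (3 * m + 3) g \<and> supp_x (2 * m + 2) g) \<and>
    (supp_x (2 * m + 3) h \<or> supp_xq (2 * m + 3) g \<longleftrightarrow> supp_t (2 * m + 2) (3 * m + 3) g \<or> supp_x (2 * m + 2) g)"
proof -
  obtain A B C where w: "g (2 * m + 2) = A" "g (2 * m + 3) = B" "g (2 * m + 4) = C" "g (2 * m + 5) = A + 3"
    "h (2 * m + 2) = B" "h (2 * m + 3) = A" "h (2 * m + 4) = C" "h (2 * m + 5) = B + 3"
    and f: "A < B" "A + B + C = 6 * m + 9"
    using assms(1) swapped_shift[OF assms(1)] by (auto simp: swapped_def algebra_simps)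
  have n: "2 * m + 2 = 2 * (m + 1)" "2 * m + 3 = 2 * (m + 1) + 1" "2 * (m + 1) + 2 = 2 * m + 4"
    "2 * (m + 1) + 3 = 2 * m + 5" by simp_all
  note w' = w[unfolded n(1,2)]
  show ?thesis
    unfolding supp_z_def n(1,2) supp_x_even supp_x_odd supp_xq_even supp_xq_odd supp_t_def n(3-) w'
    using f assms(2) by (intro conjI) (smt (verit))+
qed

section \<open>Bar-invariance from the support identities\<close>

lemma bar_fixed_C_of_bool:
  assumes fixed: "bar_fixed l (\<lambda>y. of_bool (X y) + qq * of_bool (K y))"
    and step: "\<And>y. up a y \<Longrightarrow> (P y \<longleftrightarrow> X y) \<and> (P (gn a * y) \<longleftrightarrow> X y) \<and>
      (Q (gn a * y) \<longleftrightarrow> Q y) \<and> (Q' (gn a * y) \<longleftrightarrow> Q' y) \<and>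
      (R (gn a * y) \<longleftrightarrow> R y) \<and> (K (gn a * y) \<longleftrightarrow> R y) \<and>
      (X (gn a * y) \<and> K y \<longleftrightarrow> Q y \<and> Q' y) \<and> (X (gn a * y) \<or> K y \<longleftrightarrow> Q y \<or> Q' y)"
  shows "bar_fixed (l + 1)
    (\<lambda>y. of_bool (P y) + qq * (of_bool (Q y) + of_bool (Q' y)) + vpow 4 * of_bool (R y))"
proof (rule bar_fixed_C[OF fixed, of a])
  fix y assume "up a y"
  note st = step[OF this]
  \<comment> \<open>A sum of two indicators is determined by their conjunction and disjunction,
    which is why \<open>step\<close> states the coefficient of q in that form.\<close>
  have mid: "of_bool (Q y) + of_bool (Q' y) = (of_bool (X (gn a * y)) + of_bool (K y) :: laurent)"
    using st by (cases "Q y"; cases "Q' y"; cases "X (gn a * y)"; cases "K y"; simp)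
  have top: "qq * (qq * c) = vpow 4 * c" for c by (simp add: vpow_mult_assoc)
  have "of_bool (X y) + qq * of_bool (K y) + qq * (of_bool (X (gn a * y)) + qq * of_bool (K (gn a * y))) =
      of_bool (X y) + qq * (of_bool (Q y) + of_bool (Q' y)) + vpow 4 * of_bool (R y)"
    using st by (simp add: mid distrib_left top)
  then show "of_bool (P y) + qq * (of_bool (Q y) + of_bool (Q' y)) + vpow 4 * of_bool (R y) =
      of_bool (X y) + qq * of_bool (K y) + qq * (of_bool (X (gn a * y)) + qq * of_bool (K (gn a * y))) \<and>
    of_bool (P (gn a * y)) + qq * (of_bool (Q (gn a * y)) + of_bool (Q' (gn a * y))) +
        vpow 4 * of_bool (R (gn a * y)) =
      of_bool (X y) + qq * of_bool (K y) + qq * (of_bool (X (gn a * y)) + qq * of_bool (K (gn a * y)))"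
    using st by simp
qed

lemma bar_fixed_kl_x_odd:
  assumes lab: "labelling lab" and m: "1 \<le> m"
    and x: "bar_fixed (2 * m) (kl_x lab (2 * m))"
    and t: "bar_fixed (2 * m - 1) (kl_t lab (2 * m) (3 * m))"
    and t': "bar_fixed (2 * m - 3) (kl_t lab (2 * m) (3 * m - 1))"
  shows "bar_fixed (2 * m + 1) (kl_x lab (2 * m + 1))"
proof -
  obtain a where a: "(2 * m + 1 - lab a) mod 3 = 0" using labelling_surj[OF lab] .
  have "bar_fixed (2 * m + 1) (\<lambda>y. of_bool (supp_x (2 * m + 1) (aperm lab y)) +
      qq * (of_bool (supp_xq (2 * m + 1) (aperm lab y)) + kl_t lab (2 * m) (3 * m) y) +
      vpow 4 * kl_t lab (2 * m) (3 * m - 1) y)"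
    unfolding kl_t_def using supp_odd[OF swapped_aperm[OF lab a] m]
    by (intro bar_fixed_C_of_bool[OF x[unfolded kl_x_def], of a])
  from bar_fixed_cancel[OF this t', of 2]
  have "bar_fixed (2 * m + 1) (\<lambda>y. kl_x lab (2 * m + 1) y + qq * kl_t lab (2 * m) (3 * m) y)"
    by (simp add: kl_x_def distrib_left add_ac)
  from bar_fixed_cancel[OF this t, of 1] show ?thesis by simp
qed

lemma bar_fixed_kl_x_even:
  assumes lab: "labelling lab" and m: "2 \<le> m"
    and x: "bar_fixed (2 * m - 1) (kl_x lab (2 * m - 1))"
    and z: "bar_fixed (2 * m - 2) (kl_z lab (m - 3))"
  shows "bar_fixed (2 * m) (kl_x lab (2 * m))"
proof -
  obtain a where a: "(2 * m - lab a) mod 3 = 0" using labelling_surj[OF lab] .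
  have "bar_fixed (2 * m - 1 + 1) (\<lambda>y. of_bool (supp_x (2 * m) (aperm lab y)) +
      qq * (of_bool (supp_xq (2 * m) (aperm lab y)) + of_bool (supp_z (m - 3) (aperm lab y))) +
      vpow 4 * of_bool (supp_t (2 * m - 4) (3 * m - 6) (aperm lab y)))"
    using supp_even[OF swapped_aperm[OF lab a] m]
    by (intro bar_fixed_C_of_bool[OF x[unfolded kl_x_def], of a])
  from bar_fixed_cancel[OF this z, of 1]
  show ?thesis by (simp add: kl_x_def kl_z_def distrib_left right_diff_distrib add_ac vpow_mult_assoc)
qed

lemma bar_fixed_kl_t_step:
  assumes lab: "labelling lab" and m: "0 \<le> m"
    and x: "bar_fixed (2 * m + 2) (kl_x lab (2 * m + 2))" "bar_fixed (2 * m + 1) (kl_x lab (2 * m + 1))"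
    and t: "bar_fixed (2 * m + 1) (kl_t lab (2 * m + 1) (3 * m + 2))"
  shows "bar_fixed (2 * m + 3) (kl_t lab (2 * m + 1) (3 * m + 3))"
proof -
  obtain a where a: "(2 * m + 1 - lab a) mod 3 = 0" using labelling_surj[OF lab] .
  have "bar_fixed (2 * m + 2 + 1) (\<lambda>y. of_bool (supp_t (2 * m + 1) (3 * m + 3) (aperm lab y)) +
      qq * (of_bool (supp_x (2 * m + 1) (aperm lab y)) + kl_t lab (2 * m + 1) (3 * m + 2) y) +
      vpow 4 * of_bool (supp_xq (2 * m + 1) (aperm lab y)))"
    unfolding kl_t_def using supp_t_step[OF swapped_aperm[OF lab a] m]
    by (intro bar_fixed_C_of_bool[OF x(1)[unfolded kl_x_def], of a]) blast
  from bar_fixed_cancel[OF this x(2), of 1]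
  have "bar_fixed (2 * m + 3) (\<lambda>y. kl_t lab (2 * m + 1) (3 * m + 3) y + qq * kl_t lab (2 * m + 1) (3 * m + 2) y)"
    by (simp add: kl_x_def kl_t_def distrib_left add_ac vpow_mult_assoc)
  from bar_fixed_cancel[OF this t, of 1] show ?thesis by simp
qed

lemma bar_fixed_kl_z_step:
  assumes lab: "labelling lab" and m: "0 \<le> m"
    and x: "bar_fixed (2 * m + 3) (kl_x lab (2 * m + 3))" "bar_fixed (2 * m + 2) (kl_x lab (2 * m + 2))"
  shows "bar_fixed (2 * m + 4) (kl_z lab m)"
proof -
  obtain a where a: "(2 * m + 2 - lab a) mod 3 = 0" using labelling_surj[OF lab] .
  have "bar_fixed (2 * m + 3 + 1) (\<lambda>y. of_bool (supp_z m (aperm lab y)) +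
      qq * (of_bool (supp_t (2 * m + 2) (3 * m + 3) (aperm lab y)) + of_bool (supp_x (2 * m + 2) (aperm lab y))) +
      vpow 4 * of_bool (supp_xq (2 * m + 2) (aperm lab y)))"
    using supp_z_step[OF swapped_aperm[OF lab a] m]
    by (intro bar_fixed_C_of_bool[OF x(1)[unfolded kl_x_def], of a]) blast
  from bar_fixed_cancel[OF this x(2), of 1]
  show ?thesis by (simp add: kl_x_def kl_z_def distrib_left add_ac vpow_mult_assoc)
qed

section \<open>Base cases and empty correction terms\<close>

lemma supp_x_1:
  assumes lab: "labelling lab" and a: "(1 - lab a) mod 3 = 0" and up: "up a y"
  shows "(supp_x 1 (aperm lab y) \<longleftrightarrow> y = 1) \<and> (supp_x 1 (aperm lab (gn a * y)) \<longleftrightarrow> y = 1) \<and>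
    \<not> supp_xq 1 (aperm lab y) \<and> \<not> supp_xq 1 (aperm lab (gn a * y))"
proof -
  from swapped_aperm[OF lab a up] obtain A B C where w:
    "aperm lab y 1 = A" "aperm lab y 2 = B" "aperm lab y 3 = C"
    "aperm lab (gn a * y) 1 = B" "aperm lab (gn a * y) 2 = A" "aperm lab (gn a * y) 3 = C"
    and f: "A < B" "A + B + C = 6"
    by (auto simp: swapped_def)
  have "y = 1 \<longleftrightarrow> A = 1 \<and> B = 2 \<and> C = 3"
    using eq_1_if_aperm_sorted[OF lab, of y] lab w by auto
  then show ?thesis
    using f supp_x_odd[of 0] supp_xq_odd[of 0] by (auto simp: w)
qed

lemma bar_fixed_kl_x_1:
  assumes lab: "labelling lab" shows "bar_fixed 1 (kl_x lab 1)"
proof -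
  obtain a where a: "(1 - lab a) mod 3 = 0" using labelling_surj[OF lab] .
  have "bar_fixed (0 + 1) (kl_x lab 1)"
    using supp_x_1[OF lab a] by (intro bar_fixed_C[OF bar_fixed_unit, of a]) (auto simp: kl_x_def)
  then show ?thesis by simp
qed

lemma supp_x_2:
  assumes "swapped 2 g h"
  shows "(supp_x 2 g \<longleftrightarrow> supp_x 1 g) \<and> (supp_x 2 h \<longleftrightarrow> supp_x 1 g) \<and> \<not> supp_x 1 h \<and>
    \<not> supp_xq 2 g \<and> \<not> supp_xq 2 h \<and> \<not> supp_xq 1 g \<and> \<not> supp_xq 1 h"
proof -
  obtain A B C where w: "g 2 = A" "g 3 = B" "g 4 = C" "g 1 = C - 3"
    "h 2 = B" "h 3 = A" "h 4 = C" "h 1 = C - 3"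
    and f: "A < B" "A + B + C = 9"
    using assms swapped_shift(1,2)[OF assms] by (auto simp: swapped_def)
  show ?thesis
    using f supp_x_odd[of 0] supp_xq_odd[of 0] supp_x_even[of 1] supp_xq_even[of 1] by (auto simp: w)
qed

lemma bar_fixed_kl_x_2:
  assumes lab: "labelling lab" shows "bar_fixed 2 (kl_x lab 2)"
proof -
  obtain a where a: "(2 - lab a) mod 3 = 0" using labelling_surj[OF lab] .
  have "bar_fixed (1 + 1) (kl_x lab 2)"
    using supp_x_2[OF swapped_aperm[OF lab a]]
    by (intro bar_fixed_C[OF bar_fixed_kl_x_1[OF lab], of a]) (simp add: kl_x_def)
  then show ?thesis by simp
qed

lemma kl_t_shift: "kl_t lab (i + 3 * k) (c + 3 * k) = kl_t lab i c"
proof -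
  have "aperm lab y (v + 3 * k) = aperm lab y v + 3 * k" for y v
    using aperm_shift[of "v + 3 * k" v lab y] by simp
  from this[of _ i] this[of _ "i + 1"] this[of _ "i + 2"] show ?thesis
    by (simp add: kl_t_def supp_t_def fun_eq_iff add_ac)
qed

lemma kl_t_rotate: "labelling lab \<Longrightarrow> kl_t (\<lambda>a. lab a + 1) (i + 1) (c + 1) = kl_t lab i c"
  using aperm_rotate[of lab _ i] aperm_rotate[of lab _ "i + 1"] aperm_rotate[of lab _ "i + 2"]
  by (simp add: kl_t_def supp_t_def fun_eq_iff add_ac)

text \<open>Three values at most i + 1 with sum 3i + 3 would all be equal, but they are distinct
  modulo 3.\<close>

lemma kl_t_eq_0: assumes "c \<le> i + 1" shows "kl_t lab i c = (\<lambda>_. 0)"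
proof -
  have "aperm lab y i \<noteq> aperm lab y (i + 1)" for y
    using aperm_mod_eq_iff[of lab y i "i + 1"] by auto
  then have "\<not> supp_t i c (aperm lab y)" for y
    using aperm_sum[of lab y i] assms unfolding supp_t_def by (smt (verit))
  then show ?thesis by (simp add: kl_t_def fun_eq_iff)
qed

lemma kl_z_eq_0: "kl_z lab (- 1) = (\<lambda>_. 0)"
proof -
  have "aperm lab y 0 \<noteq> aperm lab y 1" "aperm lab y 0 + aperm lab y 1 + aperm lab y 2 = 3" for y
    using aperm_mod_eq_iff[of lab y 0 1] aperm_sum[of lab y 0] by auto
  then show ?thesis
    unfolding kl_z_def supp_z_def supp_t_def by (auto simp: fun_eq_iff) (smt (verit))+
qed

text \<open>
  The induction runs over all labellings at once: a set bounded by \<open>c \<equiv> 2\<close> modulo 3 becomes one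
  bounded by \<open>c \<equiv> 0\<close> when the labels are rotated.
\<close>

lemma bar_fixed_kl_t:
  assumes base: "\<And>lab m. labelling lab \<Longrightarrow> m < M \<Longrightarrow>
      bar_fixed (2 * int m + 3) (kl_t lab (2 * int m + 1) (3 * int m + 3))"
    and lab: "labelling lab" and c: "c = i + 1 + d" "c mod 3 \<noteq> 1" "d \<le> int M" and l: "l = 2 * d + 1"
  shows "bar_fixed l (kl_t lab i c)"
proof (cases "d \<le> 0")
  case True
  then show ?thesis using c by (simp add: kl_t_eq_0 bar_fixed_zero)
next
  case False
  have zero: "bar_fixed l (kl_t lab' j e)"
    if lab': "labelling lab'" and e: "e = j + 1 + d" "e mod 3 = 0" for lab' j e
  proof -
    obtain k where k: "e = 3 * k" using e(2) by auto
    \<comment> \<open>The sets in \<open>base\<close> have offset (3m + 3) - (2m + 1) - 1 = m + 1,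
      to be matched with \<open>d\<close>; shifting by 3 (k - d) then reaches the bound
      \<open>e = 3 * k\<close>.\<close>
    define m where "m = nat (d - 1)"
    have m: "int m = d - 1" "m < M" using False c by (auto simp: m_def)
    have "bar_fixed l (kl_t lab' (2 * d - 1) (3 * d))"
      using base[OF lab' m(2)] by (simp add: m l add_ac)
    then show ?thesis
      using kl_t_shift[of lab' "2 * d - 1" "k - d" "3 * d"] e(1) k by (simp add: algebra_simps)
  qed
  consider "c mod 3 = 0" | "(c + 1) mod 3 = 0"
  proof -
    have "c mod 3 = 0 \<or> (c + 1) mod 3 = 0" using c(2) by presburger
    then show ?thesis using that by metis
  qed
  then show ?thesis
  proof cases
    case 1
    then show ?thesis by (rule zero[OF lab c(1)])
  next
    case 2
    then have "bar_fixed l (kl_t (\<lambda>a. lab a + 1) (i + 1) (c + 1))"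
      using zero[OF labelling_rotate[OF lab], of "c + 1" "i + 1"] c by simp
    then show ?thesis using kl_t_rotate[OF lab] by simp
  qed
qed

text \<open>Dependencies, with \<open>d\<close> in \<open>kl_t\<close> as in
  \<open>bar_fixed_kl_t\<close>: x_(2m+1) uses d = m - 1 and d = m - 2; x_(2m+2) uses
  \<open>kl_z lab (m - 2)\<close>, built from x_(2m-1) and x_(2m-2); the set with d = m + 1 uses the
  two new words and d = m.\<close>

lemma bar_fixed_kl_x_aux:
  "labelling lab \<Longrightarrow>
     bar_fixed (2 * int m + 1) (kl_x lab (2 * int m + 1)) \<and>
     bar_fixed (2 * int m + 2) (kl_x lab (2 * int m + 2)) \<and>
     bar_fixed (2 * int m + 3) (kl_t lab (2 * int m + 1) (3 * int m + 3))"
proof (induction m arbitrary: lab rule: less_induct)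
  case (less m)
  note lab = \<open>labelling lab\<close>
  have t: "bar_fixed l (kl_t lab i c)"
    if "c = i + 1 + d" "c mod 3 \<noteq> 1" "d \<le> int m" "l = 2 * d + 1" for l i c d
    using bar_fixed_kl_t[of m lab c i d l] less.IH lab that by blast
  have odd: "bar_fixed (2 * int m + 1) (kl_x lab (2 * int m + 1))"
  proof (cases m)
    case 0
    then show ?thesis using bar_fixed_kl_x_1[OF lab] by simp
  next
    case (Suc k)
    have "bar_fixed (2 * int m) (kl_x lab (2 * int m))"
      using less.IH[of k lab] lab Suc by (simp add: algebra_simps)
    moreover have "3 * int m mod 3 \<noteq> 1" "(3 * int m - 1) mod 3 \<noteq> 1" by presburger+
    ultimately show ?thesis
      using Suc t[of "3 * int m" "2 * int m" "int m - 1" "2 * int m - 1"]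
        t[of "3 * int m - 1" "2 * int m" "int m - 2" "2 * int m - 3"]
      by (intro bar_fixed_kl_x_odd[OF lab]) auto
  qed
  have even: "bar_fixed (2 * int m + 2) (kl_x lab (2 * int m + 2))"
  proof (cases m)
    case 0
    then show ?thesis using bar_fixed_kl_x_2[OF lab] by simp
  next
    case (Suc k)
    have "bar_fixed (2 * int m) (kl_z lab (int m - 2))"
    proof (cases k)
      case 0
      then show ?thesis using Suc by (simp add: kl_z_eq_0 bar_fixed_zero)
    next
      case (Suc j)
      with \<open>m = Suc k\<close> have j: "int m = int j + 2" "j < m" "Suc j < m" by auto
      have "bar_fixed (2 * int j + 4) (kl_z lab (int j))"
        using less.IH[OF j(2) lab] less.IH[OF j(3) lab]
        by (intro bar_fixed_kl_z_step[OF lab]) (simp_all add: add_ac)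
      then show ?thesis by (simp add: j(1) algebra_simps)
    qed
    then show ?thesis
      using bar_fixed_kl_x_even[OF lab, of "int m + 1"] odd Suc by (simp add: algebra_simps)
  qed
  have "(3 * int m + 2) mod 3 \<noteq> 1" by presburger
  then have "bar_fixed (2 * int m + 3) (kl_t lab (2 * int m + 1) (3 * int m + 3))"
    using odd even t[of "3 * int m + 2" "2 * int m + 1" "int m" "2 * int m + 1"]
    by (intro bar_fixed_kl_t_step[OF lab]) auto
  with odd even show ?case by blast
qed

lemma bar_fixed_kl_x:
  assumes "labelling lab" "1 \<le> n" shows "bar_fixed (int n) (kl_x lab (int n))"
proof -
  have "n = 2 * ((n - 1) div 2) + 1 \<or> n = 2 * ((n - 1) div 2) + 2" using assms(2) by presburger
  then obtain m where "n = 2 * m + 1 \<or> n = 2 * m + 2" by blast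
  then show ?thesis using bar_fixed_kl_x_aux[OF assms(1), of m] by (auto simp: add_ac)
qed

section \<open>Elements with a unique reduced expression\<close>

lemma supp_xq_imp_supp_x: "supp_xq n (aperm lab y) \<Longrightarrow> supp_x n (aperm lab y)"
  using aperm_sum[of lab y n] by (auto simp: supp_x_def supp_xq_def)

text \<open>These parts of the support identities show that \<open>supp_x\<close> grows with n as
  the lower Bruhat interval of a word does: by closing under left multiplication with the new
  letter.\<close>

lemma supp_x_step:
  assumes lab: "labelling lab" and n: "2 \<le> n" and a: "(int n - lab a) mod 3 = 0" and up: "up a y"
  shows "(supp_x (int n) (aperm lab y) \<longleftrightarrow> supp_x (int n - 1) (aperm lab y)) \<and>
    (supp_x (int n) (aperm lab (gn a * y)) \<longleftrightarrow> supp_x (int n - 1) (aperm lab y))"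
proof -
  note sw = swapped_aperm[OF lab a up]
  show ?thesis
  proof (cases "even n")
    case True
    then obtain m where m: "int n = 2 * int m" by (auto elim!: evenE)
    show ?thesis
    proof (cases "m = 1")
      case True
      then show ?thesis using supp_x_2 sw m by simp
    next
      case False
      then show ?thesis using supp_even[OF sw[unfolded m]] m n by auto
    qed
  next
    case False
    then obtain m where "int n = 2 * int m + 1" by (auto elim!: oddE)
    with supp_odd[OF sw[unfolded this]] n show ?thesis by auto
  qed
qed

lemma len_le_if_supp_x:
  assumes lab: "labelling lab"
  shows "1 \<le> n \<Longrightarrow> supp_x (int n) (aperm lab y) \<Longrightarrow> len y \<le> n"
proof (induction n arbitrary: y)
  case (Suc n)
  obtain a where a: "(int (Suc n) - lab a) mod 3 = 0" using labelling_surj[OF lab] .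
  define z where "z = (if up a y then y else gn a * y)"
  have z: "up a z" "y = z \<or> y = gn a * z" by (auto simp: z_def)
  have "len z \<le> n"
  proof (cases "n = 0")
    case True
    then show ?thesis using supp_x_1[OF lab, of a z] a z Suc.prems by auto
  next
    case False
    then show ?thesis using supp_x_step[OF lab _ a z(1)] z(2) Suc by auto
  qed
  then show ?case using z(2) len_gn_mult_le[of a z] by auto
qed simp

text \<open>Treats the exceptional elements in the even case of the next lemma. Two left
  multiplications move the value 6 two places down and lower \<open>k\<close> by one.\<close>

lemma len_le_if_aperm_window:
  assumes lab: "labelling lab"
  shows "aperm lab y (2 * int k + 4) = 3 * int k + 4 \<Longrightarrow> aperm lab y (2 * int k + 5) = 3 * int k + 5 \<Longrightarrow>
    aperm lab y (2 * int k + 6) = 6 \<Longrightarrow> len y \<le> 2 * k"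
proof (induction k arbitrary: y)
  case 0
  then have "y = 1"
    using aperm_add3[of lab y 1] aperm_add3[of lab y 2] aperm_add3[of lab y 3]
    by (intro eq_1_if_aperm_sorted[OF lab]) simp_all
  then show ?case by simp
next
  case (Suc k)
  obtain b where b: "(2 * int k + 7 - lab b) mod 3 = 0" using labelling_surj[OF lab] .
  obtain a where a: "(2 * int k + 6 - lab a) mod 3 = 0" using labelling_surj[OF lab] .
  define z where "z = gn a * (gn b * y)"
  have y: "aperm lab y (2 * int k + 6) = 3 * int k + 7" "aperm lab y (2 * int k + 7) = 3 * int k + 8"
    "aperm lab y (2 * int k + 8) = 6" "aperm lab y (2 * int k + 9) = 3 * int k + 10"
    using Suc.prems aperm_add3[of lab y "2 * int k + 6"] by (simp_all add: algebra_simps)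
  have z1: "aperm lab (gn b * y) (2 * int k + 7) = 6" "aperm lab (gn b * y) (2 * int k + 8) = 3 * int k + 8"
    "aperm lab (gn b * y) (2 * int k + 6) = 3 * int k + 7"
    using aperm_gn_mult_window[OF lab b, of y] aperm_add3[of lab "gn b * y" "2 * int k + 6"] y
    by (simp_all add: add.assoc)
  have "aperm lab z (2 * int k + 6) = 6" "aperm lab z (2 * int k + 7) = 3 * int k + 7"
    "aperm lab z (2 * int k + 8) = 3 * int k + 8"
    using aperm_gn_mult_window[OF lab a, of "gn b * y"] z1 by (simp_all add: z_def add.assoc)
  then have "len z \<le> 2 * k"
    using aperm_add3[of lab z "2 * int k + 4"] aperm_add3[of lab z "2 * int k + 5"]
    by (intro Suc.IH) (simp_all add: add.assoc)
  moreover have "y = gn b * (gn a * z)" by (simp add: z_def)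
  ultimately show ?case
    using len_gn_mult_le[of b "gn a * z"] len_gn_mult_le[of a z] by simp
qed

text \<open>This is the degree bound for the coefficient q. The condition implies
  \<open>supp_x\<close> for n - 3, which bounds the length, except for even n when the value at n +
  2 is 6: then the value at n - 1 is 3 and may miss the lower bound 4.\<close>

lemma len_le_if_supp_xq:
  assumes lab: "labelling lab" and K: "supp_xq (int n) (aperm lab y)"
  shows "len y + 3 \<le> n"
proof (cases "even n")
  case False
  then obtain m where m: "n = 2 * m + 1" by (auto elim!: oddE)
  let ?i = "2 * int m + 1"
  define A B C where w': "A = aperm lab y ?i" "B = aperm lab y (2 * int m + 2)" "C = aperm lab y (2 * int m + 3)"
  note w = w'[symmetric]
  have f: "A + B + C = 6 * int m + 6" "A \<noteq> B"
    using aperm_sum[of lab y ?i] aperm_mod_eq_iff[of lab y ?i "2 * int m + 2"]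
    unfolding w' by (auto simp: add.assoc)
  have bnd: "A \<le> 3 * int m" "B \<le> 3 * int m" "C \<le> 3 * int m + 2"
    using K[unfolded m] supp_xq_odd[of "int m" "aperm lab y"] w by (simp_all add: add_ac)
  then have m2: "2 \<le> m" using f by linarith
  \<comment> \<open>\<open>A \<noteq> B\<close> sharpens A + B \<le> 6m to 6m - 1, so C \<ge> 7,
    which is the lower bound in \<open>supp_x\<close> after the shift by 3.\<close>
  have "supp_x (2 * (int m - 1)) (aperm lab y)"
    unfolding supp_x_even
    using f bnd aperm_add3[of lab y "2 * int m - 2"] aperm_add3[of lab y "2 * int m - 1"]
      aperm_add3[of lab y "2 * int m"] w by (simp add: add_ac)
  then have "len y \<le> 2 * (m - 1)"
    using len_le_if_supp_x[OF lab, of "2 * (m - 1)" y] m2 by (simp add: of_nat_diff)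
  then show ?thesis using m m2 by simp
next
  case True
  then obtain m where m: "n = 2 * m" by (auto elim!: evenE)
  let ?i = "2 * int m"
  define A B C where w': "A = aperm lab y ?i" "B = aperm lab y (?i + 1)" "C = aperm lab y (?i + 2)"
  note w = w'[symmetric]
  have f: "A + B + C = 6 * int m + 3" "A \<noteq> B"
    using aperm_sum[of lab y ?i] aperm_mod_eq_iff[of lab y ?i "?i + 1"] unfolding w' by auto
  have bnd: "A \<le> 3 * int m - 1" "B \<le> 3 * int m - 1" "C \<le> 3 * int m"
    using K[unfolded m] supp_xq_even[of "int m" "aperm lab y"] w by simp_all
  then have m2: "2 \<le> m" using f by linarith
  then obtain k where k: "m = k + 2" by (metis add.commute le_Suc_ex)
  show ?thesis
  proof (cases "C = 6")
    case True
    then have AB: "A = 3 * int m - 2 \<and> B = 3 * int m - 1 \<or> A = 3 * int m - 1 \<and> B = 3 * int m - 2"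
      using bnd f by linarith
    obtain a where a: "(2 * int m - lab a) mod 3 = 0" using labelling_surj[OF lab] .
    define z where "z = (if A < B then y else gn a * y)"
    have "aperm lab z ?i = 3 * int m - 2" "aperm lab z (?i + 1) = 3 * int m - 1" "aperm lab z (?i + 2) = 6"
      using AB aperm_gn_mult_window[OF lab a, of y] w True by (auto simp: z_def)
    then have "len z \<le> 2 * k"
      by (intro len_le_if_aperm_window[OF lab]) (simp_all add: k add_ac)
    moreover have "y = z \<or> y = gn a * z" by (auto simp: z_def)
    ultimately show ?thesis using len_gn_mult_le[of a z] m k by auto
  next
    case False
    have "supp_x (2 * int k + 1) (aperm lab y)"
      unfolding supp_x_odd
      using f bnd False aperm_add3[of lab y "2 * int k + 1"] aperm_add3[of lab y "2 * int k + 2"]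
        aperm_add3[of lab y "2 * int k + 3"] w by (auto simp: k add_ac)
    then have "len y \<le> 2 * k + 1"
      using len_le_if_supp_x[OF lab, of "2 * k + 1" y] by (simp add: add_ac)
    then show ?thesis using m k by simp
  qed
qed

section \<open>Periodic words and their Kazhdan--Lusztig polynomials\<close>

fun periodic :: "(gen \<Rightarrow> int) \<Rightarrow> gen list \<Rightarrow> bool" where
  "periodic lab [] \<longleftrightarrow> True"
| "periodic lab (a # xs) \<longleftrightarrow> (int (Suc (length xs)) - lab a) mod 3 = 0 \<and> periodic lab xs"

text \<open>Supports grow by left multiplication with the next letter, and the lifting property
  keeps the new elements below the longer word. This gives the vanishing outside the interval
  required by \<open>kl_family\<close>.\<close>

lemma supp_x_periodic:
  assumes lab: "labelling lab"
  shows "periodic lab xs \<Longrightarrow> length xs = len (word xs) \<Longrightarrow> xs \<noteq> [] \<Longrightarrow>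
    supp_x (int (length xs)) (aperm lab (word xs)) \<and>
    (\<forall>y. supp_x (int (length xs)) (aperm lab y) \<longrightarrow> y \<le> word xs)"
proof (induction xs)
  case (Cons a xs)
  have w: "word (a # xs) = gn a * word xs" by (rule word_Cons)
  have len: "length xs = len (word xs)"
    using Cons.prems len_word_le[of xs] len_gn_mult_le[of a "word xs"] unfolding w by simp
  have up: "up a (word xs)" using Cons.prems len unfolding w by simp
  have a: "(int (length (a # xs)) - lab a) mod 3 = 0" and p: "periodic lab xs" using Cons.prems(1) by simp_all
  have le: "z \<le> word (a # xs) \<and> gn a * z \<le> word (a # xs)" if "z \<le> word xs" for z
    unfolding w using that gn_mult_le_gn_mult[OF that up] le_gn_mult[OF up] by auto
  have "supp_x (int (length (a # xs))) (aperm lab (word (a # xs))) \<and>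
      (\<forall>z. up a z \<longrightarrow> supp_x (int (length (a # xs))) (aperm lab z) \<or>
        supp_x (int (length (a # xs))) (aperm lab (gn a * z)) \<longrightarrow> z \<le> word xs)"
  proof (cases "xs = []")
    case True
    then show ?thesis using supp_x_1[OF lab, of a] supp_x_1[OF lab, of a 1] a up unfolding w by (auto simp: word_Nil)
  next
    case False
    then have n: "2 \<le> length (a # xs)" by (cases xs) auto
    show ?thesis using supp_x_step[OF lab n a] Cons.IH[OF p len False] up unfolding w by auto
  qed
  then show ?case using le by (metis gn_gn_left len_gn_mult_less)
qed simp

lemma laurent_of_qpoly_of_bool:
  "laurent_of_qpoly [:of_bool P, of_bool Q:] = of_bool P + qq * of_bool Q"
  by (cases P; cases Q) (simp_all add: laurent_of_qpoly_def vpow_def)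

lemma KL_periodic:
  assumes lab: "labelling lab" and xs: "periodic lab xs" "length xs = len (word xs)" "xs \<noteq> []"
  shows "KL y (word xs) =
    [:of_bool (supp_x (int (length xs)) (aperm lab y)), of_bool (supp_xq (int (length xs)) (aperm lab y)):]"
proof -
  define n where "n = length xs"
  define p :: "weyl \<Rightarrow> int poly" where
    "p y = [:of_bool (supp_x (int n) (aperm lab y)), of_bool (supp_xq (int n) (aperm lab y)):]" for y
  have n: "1 \<le> n" "len (word xs) = n" using xs(2,3) by (cases xs; simp add: n_def)+
  have top: "supp_x (int n) (aperm lab (word xs))"
    and supp: "supp_x (int n) (aperm lab y) \<Longrightarrow> y \<le> word xs" for y
    using supp_x_periodic[OF lab xs] by (simp_all add: n_def)
  have q: "len y + 3 \<le> n" if "supp_xq (int n) (aperm lab y)" for y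
    using len_le_if_supp_xq[OF lab that] .
  have "kl_family (word xs) p"
    unfolding kl_family_def
  proof (intro conjI allI impI)
    show "p (word xs) = 1" using top q[of "word xs"] n by (auto simp: p_def one_pCons)
    show "p y = 0" if "\<not> y \<le> word xs" for y
      using that supp[of y] supp_xq_imp_supp_x[of "int n" lab y] by (auto simp: p_def)
    show "2 * int (degree (p y)) \<le> int (len (word xs)) - int (len y) - 1" if "y < word xs" for y
    proof (cases "supp_xq (int n) (aperm lab y)")
      case True
      then show ?thesis using q[OF True] n by (simp add: p_def)
    next
      case False
      then have "degree (p y) = 0" by (simp add: p_def)
      moreover have "len y < len (word xs)"
        using that bruhat_steps_len[of y "word xs"] by (auto simp: less_weyl_def less_eq_weyl_def)
      ultimately show ?thesis by simp
    qed
    obtain h where h: "hecke_bar h = h" "\<And>y. lk h y = vpow (- int n) * kl_x lab (int n) y"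
      using bar_fixed_kl_x[OF lab n(1)] by (auto simp: bar_fixed_def)
    have "kl_element (word xs) p = h"
    proof (rule hecke_eqI)
      fix y
      show "lk (kl_element (word xs) p) y = lk h y"
        using supp[of y] supp_xq_imp_supp_x[of "int n" lab y]
        by (auto simp: lookup_kl_element h n p_def kl_x_def laurent_of_qpoly_of_bool)
    qed
    then show "hecke_bar (kl_element (word xs) p) = kl_element (word xs) p" using h by simp
  qed
  from KL_eqI[OF this] show ?thesis by (simp add: p_def n_def)
qed

lemma labelling_exists:
  assumes "a \<noteq> b" obtains lab where "labelling lab" "lab b = 1" "lab a = 2"
proof
  let ?lab = "\<lambda>c. if c = b then 1 else if c = a then 2 else 3 :: int"
  have third: "c = d" if "c \<noteq> a" "c \<noteq> b" "d \<noteq> a" "d \<noteq> b" for c d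
    using that assms by (cases a; cases b; cases c; cases d) auto
  show "labelling ?lab"
    unfolding labelling_def
  proof (intro allI impI)
    fix c d :: gen assume "c \<noteq> d"
    then show "(?lab c - ?lab d) mod 3 \<noteq> 0"
      using third[of c d] by (cases "c = a"; cases "c = b"; cases "d = a"; cases "d = b"; simp)
  qed
qed (use assms in auto)

text \<open>Bounding the length of \<open>ys\<close> puts reducedness and uniqueness into one
  condition that passes to tails. It forbids initial factors \<open>a a\<close> and
  \<open>a b a\<close>, so any three consecutive letters are distinct and the third determines the
  next residue together with the second.\<close>

lemma periodic_if_unique:
  assumes "\<And>ys. word ys = word xs \<Longrightarrow> length ys \<le> length xs \<Longrightarrow> ys = xs"
  shows "\<exists>lab. labelling lab \<and> periodic lab xs"
  using assms
proof (induction xs rule: induct_list012)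
  case 1
  then show ?case using labelling_exists[of gen_r gen_s] by auto
next
  case (2 a)
  obtain b where "b \<noteq> a" by (cases a) auto
  then obtain lab where "labelling lab" "lab a = 1" by (rule labelling_exists)
  then show ?case by (intro exI[of _ lab]) simp
next
  case (3 a b xs)
  have ab: "a \<noteq> b"
  proof
    assume "a = b"
    then have "word (a # b # xs) = word xs"
      using word_Cons[of a "b # xs"] word_Cons[of b xs] by simp
    then show False using 3(3)[of xs] by simp
  qed
  have uniq: "ys = b # xs" if "word ys = word (b # xs)" "length ys \<le> length (b # xs)" for ys
  proof -
    have "word (a # ys) = word (a # b # xs)" using that(1) by (metis word_Cons)
    then have "a # ys = a # b # xs" using that(2) by (intro 3(3)) simp_all
    then show ?thesis by simp
  qed
  show ?case
  proof (cases xs)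
    case Nil
    obtain lab where "labelling lab" "lab b = 1" "lab a = 2" using labelling_exists[OF ab] .
    then show ?thesis using Nil by (intro exI[of _ lab]) simp
  next
    case (Cons c zs)
    have "a \<noteq> c"
    proof
      assume "a = c"
      then have "word (b # a # b # zs) = word (a # b # xs)"
        using gn_braid[OF ab, of "word zs"] Cons by (metis word_Cons)
      then show False using 3(3)[of "b # a # b # zs"] ab Cons by auto
    qed
    obtain lab where lab: "labelling lab" and p: "periodic lab (b # xs)" using 3(2)[OF uniq] by blast
    have "(lab a - lab b) mod 3 \<noteq> 0" "(lab a - lab c) mod 3 \<noteq> 0"
      using lab ab \<open>a \<noteq> c\<close> by (simp_all add: labelling_def)
    moreover have "(int (length zs) + 2 - lab b) mod 3 = 0" "(int (length zs) + 1 - lab c) mod 3 = 0"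
      using p Cons by (simp_all add: add_ac)
    \<comment> \<open>The letters \<open>b\<close> and \<open>c\<close> occupy two of the three
      residues, leaving one for \<open>a\<close>.\<close>
    ultimately have "(int (length zs) + 3 - lab a) mod 3 = 0" by presburger
    then show ?thesis using lab p Cons by (intro exI[of _ lab]) (simp add: add_ac)
  qed
qed

theorem theorem6p11:
  fixes u w :: weyl
  assumes "u < w" and "u \<in> c0" and "w \<in> c1" and "int (len w) - int (len u) \<ge> 5"
  shows "mu u w = 0"
proof -
  obtain xs where xs: "reduced_expr xs w" and uniq: "\<And>ys. reduced_expr ys w \<Longrightarrow> ys = xs" and "w \<noteq> 1"
    using assms(3) by (auto simp: c1_def)
  have w: "w = word xs" "length xs = len (word xs)" using xs by (auto simp: reduced_expr_def)
  have "ys = xs" if "word ys = word xs" "length ys \<le> length xs" for ys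
    using that uniq len_word_le[of ys] w unfolding reduced_expr_def by (metis le_antisym)
  from periodic_if_unique[OF this] obtain lab where "labelling lab" "periodic lab xs" by blast
  moreover have "xs \<noteq> []" using \<open>w \<noteq> 1\<close> w(1) by (auto simp: word_Nil)
  ultimately have "degree (KL u w) \<le> 1" unfolding w(1) by (subst KL_periodic[OF _ _ w(2)]) simp_all
  then have "coeff (KL u w) ((len w - len u - 1) div 2) = 0"
    using assms(4) by (intro coeff_eq_0) linarith
  then show ?thesis by (simp add: mu_def)
qed

end
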